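(* Let $\mathfrak{h}$ be the Lie algebra of vector fields on $\mathbb{R}^3$ spanned by $$p,\quad q,\quad xp,\quad yq,\quad xq,\quad yp,\quad x^2p+xyq,\quad xyp+y^2q.$$ For every smooth function $K(z)$, the linear map $F_K:\mathfrak{h}\to\mathcal{F}(\mathbb{R}^3)/\{1\}$ defined by $$\eta_p=\eta_q=\eta_{xq}=\eta_{yp}=0,\qquad \eta_{xp}=\eta_{yq}=K(z),\qquad \eta_{x^2p+xyq}=3xK(z),\qquad \eta_{xyp+y^2q}=3yK(z)$$ (where $\eta_v=\langle F_K;v\rangle$) is a $1$-cocycle, and every cohomology class in $H^1(\mathfrak{h},\mathcal{F}(\mathbb{R}^3)/\{1\})$ is represented by $F_K$ for some function $K(z)$. Consequently, every Lie algebra of first order differential operators associated with a triple $(\mathfrak{h},\{1\},[F])$ is equivalent, under a gauge transformation, to $$\mathrm{Span}\{p,\ q,\ xp+K(z),\ yp,\ xq,\ yq+K(z),\ x^2p+xyq+3xK(z),\ xyp+y^2q+3yK(z),\ 1\}$$ for some function $K(z)$.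
   Context: Notation: $(x,y,z)$ are coordinates on $\mathbb{R}^3$, and $p=\partial/\partial x$, $q=\partial/\partial y$. $\mathcal{F}(\mathbb{R}^3)$ is the space of smooth real-valued functions, on which vector fields act by derivation, and $\{1\}$ is the subspace of constant functions. A $1$-cochain on a finite-dimensional Lie algebra $\mathfrak{h}$ of vector fields is a linear map $F:\mathfrak{h}\to\mathcal{F}(\mathbb{R}^3)/\{1\}$, $v\mapsto\langle F;v\rangle=\eta_v$. It is a $1$-cocycle if $v(\eta_w)-w(\eta_v)-\eta_{[v,w]}\in\{1\}$ for all $v,w\in\mathfrak{h}$. The $0$-coboundary of $\lambda\in\mathcal{F}(\mathbb{R}^3)$ is $\langle\delta_0\lambda;v\rangle=v(\lambda)$ modulo constants. $H^1(\mathfrak{h},\mathcal{F}(\mathbb{R}^3)/\{1\})$ is the space of $1$-cocycles modulo $0$-coboundaries. A first order differential operator is $T=v+\eta$ with $v$ a vector field and $\eta$ a function acting by multiplication; the bracket is the commutator $[v^1+\eta^1,v^2+\eta^2]=[v^1,v^2]+v^1(\eta^2)-v^2(\eta^1)$. The Lie algebra associated with a triple $(\mathfrak{h},\{1\},[F])$ is the span of the operators $v+\eta_v$, $v\in\mathfrak{h}$ (with $\eta_v$ any representative modulo constants), together with the constant multiplication operator $1$; changing the representative $F$ by a coboundary corresponds to a gauge transformation $T\mapsto e^{\lambda}Te^{-\lambda}$. *)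

theory Defs
  imports "HOL-Analysis.Analysis" "HOL-Library.Function_Algebras"
begin

primrec Ck :: "nat \<Rightarrow> ('a::euclidean_space \<Rightarrow> real) \<Rightarrow> bool" where
  "Ck 0 f \<longleftrightarrow> continuous_on UNIV f"
| "Ck (Suc n) f \<longleftrightarrow> (\<forall>x. f differentiable (at x)) \<and>
     (\<forall>v. Ck n (\<lambda>x. frechet_derivative f (at x) v))"

definition smooth :: "('a::euclidean_space \<Rightarrow> real) \<Rightarrow> bool" where
  "smooth f \<longleftrightarrow> (\<forall>n. Ck n f)"

lemma Ck_SucD: "Ck (Suc n) f \<Longrightarrow> Ck n f"
proof (induction n arbitrary: f)
  case 0
  then show ?case
    by (auto intro!: differentiable_imp_continuous_on simp: differentiable_on_def
        intro: differentiable_at_withinI)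
next
  case (Suc n)
  then show ?case by (auto simp del: Ck.simps(1)) 
qed

lemma Ck_const: "Ck n (\<lambda>x. c)"
  by (induction n arbitrary: c) simp_all

lemma Ck_linear:
  assumes "bounded_linear f"
  shows "Ck n f"
proof (cases n)
  case 0
  with assms show ?thesis by (simp add: linear_continuous_on)
next
  case (Suc m)
  have "(f has_derivative f) (at x)" for x
    by (rule bounded_linear_imp_has_derivative[OF assms])
  then have "f differentiable (at x)" "frechet_derivative f (at x) = f" for x
    by (auto simp: differentiable_def frechet_derivative_at[symmetric])
  with Suc show ?thesis by (simp add: Ck_const)
qed

lemma Ck_add: "Ck n f \<Longrightarrow> Ck n g \<Longrightarrow> Ck n (\<lambda>x. f x + g x)"
proof (induction n arbitrary: f g)
  case (Suc n)
  have D: "((\<lambda>x. f x + g x) has_derivative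
      (\<lambda>v. frechet_derivative f (at x) v + frechet_derivative g (at x) v)) (at x)" for x
    using Suc.prems by (intro has_derivative_add) (simp_all add: frechet_derivative_works[symmetric])
  then have "frechet_derivative (\<lambda>x. f x + g x) (at x) v
      = frechet_derivative f (at x) v + frechet_derivative g (at x) v" for x v
    by (simp add: frechet_derivative_at[OF D, symmetric])
  with Suc show ?case by simp
qed (auto intro: continuous_on_add)

lemma Ck_mult: "Ck n f \<Longrightarrow> Ck n g \<Longrightarrow> Ck n (\<lambda>x. f x * g x)"
proof (induction n arbitrary: f g)
  case (Suc n)
  have D: "((\<lambda>x. f x * g x) has_derivative
      (\<lambda>v. f x * frechet_derivative g (at x) v + frechet_derivative f (at x) v * g x)) (at x)"
    for x
    using Suc.prems by (intro has_derivative_mult) (simp_all add: frechet_derivative_works[symmetric])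
  then have "frechet_derivative (\<lambda>x. f x * g x) (at x) v
      = f x * frechet_derivative g (at x) v + frechet_derivative f (at x) v * g x" for x v
    by (simp add: frechet_derivative_at[OF D, symmetric])
  moreover have "Ck n f" "Ck n g" using Suc.prems by (blast intro: Ck_SucD)+
  ultimately show ?case using Suc by (auto intro!: Ck_add)
qed (auto intro: continuous_on_mult)

lemma Ck_exp: "Ck n f \<Longrightarrow> Ck n (\<lambda>x. exp (f x))"
proof (induction n arbitrary: f)
  case (Suc n)
  have D: "((\<lambda>x. exp (f x)) has_derivative
      (\<lambda>v. exp (f x) * frechet_derivative f (at x) v)) (at x)" for x
  proof -
    have "(f has_derivative frechet_derivative f (at x)) (at x)"
      using Suc.prems by (simp add: frechet_derivative_works[symmetric])
    from has_derivative_exp[OF this] show ?thesis by (simp add: mult.commute)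
  qed
  then have "frechet_derivative (\<lambda>x. exp (f x)) (at x) v
      = exp (f x) * frechet_derivative f (at x) v" for x v
    by (simp add: frechet_derivative_at[OF D, symmetric])
  moreover have "(\<lambda>x. exp (f x)) differentiable (at x)" for x
    using D by (auto simp: differentiable_def)
  moreover have "Ck n f" using Suc.prems by (rule Ck_SucD)
  ultimately show ?case using Suc by (auto intro!: Ck_mult)
qed (auto intro: continuous_on_exp)

lemma Ck_compose_linear:
  fixes L :: "'a::euclidean_space \<Rightarrow> 'b::euclidean_space"
  assumes L: "bounded_linear L"
  shows "Ck n f \<Longrightarrow> Ck n (\<lambda>x. f (L x))"
proof (induction n arbitrary: f)
  case 0
  then show ?case
    using continuous_on_compose2[of UNIV f UNIV L] linear_continuous_on[OF L] by auto
next
  case (Suc n)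
  have D: "((\<lambda>x. f (L x)) has_derivative
      (\<lambda>v. frechet_derivative f (at (L x)) (L v))) (at x)" for x
  proof -
    have "(f has_derivative frechet_derivative f (at (L x))) (at (L x))"
      using Suc.prems by (simp add: frechet_derivative_works[symmetric])
    with bounded_linear_imp_has_derivative[OF L] show ?thesis
      by (rule has_derivative_compose)
  qed
  then have "frechet_derivative (\<lambda>x. f (L x)) (at x) v
      = frechet_derivative f (at (L x)) (L v)" for x v
    by (simp add: frechet_derivative_at[OF D, symmetric])
  moreover have "(\<lambda>x. f (L x)) differentiable (at x)" for x
    using D by (auto simp: differentiable_def)
  moreover have "Ck n (\<lambda>x. frechet_derivative f (at (L x)) (L v))" for v
    using Suc.prems by (intro Suc.IH[of "\<lambda>y. frechet_derivative f (at y) (L v)"]) simp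
  ultimately show ?case by simp
qed

typedef (overloaded) 'a smooth_fun = "{f :: 'a::euclidean_space \<Rightarrow> real. smooth f}"
  by (rule exI[of _ "\<lambda>_. 0"]) (simp add: smooth_def Ck_const)

setup_lifting type_definition_smooth_fun

instantiation smooth_fun :: (euclidean_space) "{comm_ring_1, real_algebra_1}"
begin

lift_definition zero_smooth_fun :: "'a smooth_fun" is "\<lambda>_. 0"
  by (simp add: smooth_def Ck_const)
lift_definition one_smooth_fun :: "'a smooth_fun" is "\<lambda>_. 1"
  by (simp add: smooth_def Ck_const)
lift_definition plus_smooth_fun :: "'a smooth_fun \<Rightarrow> 'a smooth_fun \<Rightarrow> 'a smooth_fun"
  is "\<lambda>f g x. f x + g x"
  by (simp add: smooth_def Ck_add)
lift_definition times_smooth_fun :: "'a smooth_fun \<Rightarrow> 'a smooth_fun \<Rightarrow> 'a smooth_fun"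
  is "\<lambda>f g x. f x * g x"
  by (simp add: smooth_def Ck_mult)
lift_definition scaleR_smooth_fun :: "real \<Rightarrow> 'a smooth_fun \<Rightarrow> 'a smooth_fun"
  is "\<lambda>c f x. c * f x"
  by (simp add: smooth_def Ck_mult Ck_const)
lift_definition uminus_smooth_fun :: "'a smooth_fun \<Rightarrow> 'a smooth_fun"
  is "\<lambda>f x. - f x"
  using Ck_mult[OF Ck_const[where c = "-1"]] by (auto simp: smooth_def)
lift_definition minus_smooth_fun :: "'a smooth_fun \<Rightarrow> 'a smooth_fun \<Rightarrow> 'a smooth_fun"
  is "\<lambda>f g x. f x - g x"
  using Ck_add[OF _ Ck_mult[OF Ck_const[where c = "-1"]]] by (fastforce simp: smooth_def)

instance
  by standard (transfer; simp add: fun_eq_iff algebra_simps)+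

end

lift_definition exp_smooth :: "'a::euclidean_space smooth_fun \<Rightarrow> 'a smooth_fun"
  is "\<lambda>f x. exp (f x)"
  by (simp add: smooth_def Ck_exp)

lift_definition dir_deriv :: "'a::euclidean_space \<Rightarrow> 'a smooth_fun \<Rightarrow> 'a smooth_fun"
  is "\<lambda>v f x. frechet_derivative f (at x) v"
  unfolding smooth_def using Ck.simps(2) by blast

type_synonym F3 = "(real^3) smooth_fun"

lift_definition coord :: "3 \<Rightarrow> F3" is "\<lambda>i u. u $ i"
  by (simp add: smooth_def Ck_linear bounded_linear_vec_nth)

lift_definition of_z :: "real smooth_fun \<Rightarrow> F3" is "\<lambda>K u. K (u $ 3)"
  by (simp add: smooth_def Ck_compose_linear[OF bounded_linear_vec_nth])

abbreviation "cx \<equiv> coord 1"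
abbreviation "cy \<equiv> coord 2"

text \<open>Vector fields and first order differential operators are represented by their action
  on smooth functions, i.e. as elements of the vector space of maps from \<open>F3\<close> to \<open>F3\<close>
  with the pointwise operations.\<close>

instantiation "fun" :: (type, real_vector) real_vector
begin

definition scaleR_fun :: "real \<Rightarrow> ('a \<Rightarrow> 'b) \<Rightarrow> 'a \<Rightarrow> 'b" where
  "scaleR_fun c f = (\<lambda>x. c *\<^sub>R f x)"

instance
  by standard (simp_all add: scaleR_fun_def fun_eq_iff algebra_simps)

end

type_synonym oper = "F3 \<Rightarrow> F3"

definition mult_op :: "F3 \<Rightarrow> oper" where
  "mult_op \<eta> = (\<lambda>f. \<eta> * f)"

definition fmul :: "F3 \<Rightarrow> oper \<Rightarrow> oper" (infixr "\<odot>" 68) where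
  "g \<odot> v = (\<lambda>f. g * v f)"

definition bracket :: "oper \<Rightarrow> oper \<Rightarrow> oper" where
  "bracket S T = (\<lambda>f. S (T f) - T (S f))"

definition p :: oper where "p = dir_deriv (axis 1 1)"
definition q :: oper where "q = dir_deriv (axis 2 1)"

definition \<hh> :: "oper set" where
  "\<hh> = span {p, q, cx \<odot> p, cy \<odot> q, cx \<odot> q, cy \<odot> p,
     cx\<^sup>2 \<odot> p + cx * cy \<odot> q, cx * cy \<odot> p + cy\<^sup>2 \<odot> q}"

text \<open>Here \<open>span {1}\<close> is the space of constant functions.\<close>

lifting_forget smooth_fun.lifting

quotient_type F3_mod_const = F3 / "\<lambda>f g :: F3. f - g \<in> span {1}"
proof (rule equivpI)
  show "reflp (\<lambda>f g :: F3. f - g \<in> span {1})"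
    by (rule reflpI) (simp only: diff_self span_zero)
  show "symp (\<lambda>f g :: F3. f - g \<in> span {1})"
  proof (rule sympI)
    fix f g :: F3
    assume "f - g \<in> span {1}"
    from span_neg[OF this] show "g - f \<in> span {1}" by (simp only: minus_diff_eq)
  qed
  show "transp (\<lambda>f g :: F3. f - g \<in> span {1})"
  proof (rule transpI)
    fix f g h :: F3
    assume "f - g \<in> span {1}" "g - h \<in> span {1}"
    from span_add[OF this] show "f - h \<in> span {1}" by simp
  qed
qed

instantiation F3_mod_const :: real_vector
begin

lift_definition zero_F3_mod_const :: F3_mod_const is "0 :: F3" .
lift_definition plus_F3_mod_const :: "F3_mod_const \<Rightarrow> F3_mod_const \<Rightarrow> F3_mod_const"
  is "(+) :: F3 \<Rightarrow> F3 \<Rightarrow> F3"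
  by (simp only: add_diff_add span_add)
lift_definition scaleR_F3_mod_const :: "real \<Rightarrow> F3_mod_const \<Rightarrow> F3_mod_const"
  is "scaleR :: real \<Rightarrow> F3 \<Rightarrow> F3"
  by (simp only: scaleR_diff_right[symmetric] span_scale)
lift_definition uminus_F3_mod_const :: "F3_mod_const \<Rightarrow> F3_mod_const"
  is "uminus :: F3 \<Rightarrow> F3"
  by (simp only: minus_diff_minus span_neg)
lift_definition minus_F3_mod_const :: "F3_mod_const \<Rightarrow> F3_mod_const \<Rightarrow> F3_mod_const"
  is "(-) :: F3 \<Rightarrow> F3 \<Rightarrow> F3"
proof -
  fix f g h k :: F3
  assume "f - g \<in> span {1}" "h - k \<in> span {1}"
  from span_diff[OF this] show "(f - h) - (g - k) \<in> span {1}" by (simp add: algebra_simps)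
qed

instance
  by standard (transfer; simp add: algebra_simps span_zero)+

end

lift_definition mod_const :: "F3 \<Rightarrow> F3_mod_const" is "\<lambda>f :: F3. f" .

text \<open>A linear map on a subspace \<open>H\<close> is encoded as a total function that vanishes
  outside \<open>H\<close>, so that equality of cochains is equality on \<open>H\<close>.\<close>

definition cochains1 :: "oper set \<Rightarrow> (oper \<Rightarrow> F3_mod_const) set" where
  "cochains1 H = {F. (\<forall>v. v \<notin> H \<longrightarrow> F v = 0) \<and>
     (\<forall>v\<in>H. \<forall>w\<in>H. F (v + w) = F v + F w) \<and>
     (\<forall>c. \<forall>v\<in>H. F (c *\<^sub>R v) = c *\<^sub>R F v)}"

definition cocycles1 :: "oper set \<Rightarrow> (oper \<Rightarrow> F3_mod_const) set" where
  "cocycles1 H = {F \<in> cochains1 H. \<forall>v\<in>H. \<forall>w\<in>H. \<forall>\<eta>\<^sub>v \<eta>\<^sub>w \<eta>\<^sub>v\<^sub>w.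
     mod_const \<eta>\<^sub>v = F v \<longrightarrow> mod_const \<eta>\<^sub>w = F w \<longrightarrow> mod_const \<eta>\<^sub>v\<^sub>w = F (bracket v w) \<longrightarrow>
     v \<eta>\<^sub>w - w \<eta>\<^sub>v - \<eta>\<^sub>v\<^sub>w \<in> span {1}}"

definition coboundary0 :: "oper set \<Rightarrow> F3 \<Rightarrow> oper \<Rightarrow> F3_mod_const" where
  "coboundary0 H \<mu> = (\<lambda>v. if v \<in> H then mod_const (v \<mu>) else 0)"

definition H1 :: "oper set \<Rightarrow> (oper \<Rightarrow> F3_mod_const) set set" where
  "H1 H = cocycles1 H //
     {(F, G). F \<in> cocycles1 H \<and> G \<in> cocycles1 H \<and> F - G \<in> range (coboundary0 H)}"

definition assoc_algebra :: "oper set \<Rightarrow> (oper \<Rightarrow> F3_mod_const) \<Rightarrow> oper set" where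
  "assoc_algebra H F =
     span ({v + mult_op \<eta> | v \<eta>. v \<in> H \<and> mod_const \<eta> = F v} \<union> {mult_op 1})"

definition gauge_transform :: "F3 \<Rightarrow> oper \<Rightarrow> oper" where
  "gauge_transform \<mu> T = mult_op (exp_smooth \<mu>) \<circ> T \<circ> mult_op (exp_smooth (- \<mu>))"

definition is_F_K :: "real smooth_fun \<Rightarrow> (oper \<Rightarrow> F3_mod_const) \<Rightarrow> bool" where
  "is_F_K K F \<longleftrightarrow> F \<in> cochains1 \<hh> \<and>
     F p = 0 \<and> F q = 0 \<and> F (cx \<odot> q) = 0 \<and> F (cy \<odot> p) = 0 \<and>
     F (cx \<odot> p) = mod_const (of_z K) \<and>
     F (cy \<odot> q) = mod_const (of_z K) \<and>
     F (cx\<^sup>2 \<odot> p + cx * cy \<odot> q) = mod_const (3 * cx * of_z K) \<and>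
     F (cx * cy \<odot> p + cy\<^sup>2 \<odot> q) = mod_const (3 * cy * of_z K)"

definition F_K :: "real smooth_fun \<Rightarrow> oper \<Rightarrow> F3_mod_const" where
  "F_K K = (THE F. is_F_K K F)"

end

theory Submission
  imports Defs
begin

text \<open>The values of \<open>F_K\<close> on the generators are \<open>K\<close> times the divergence of the generator in the
  \<open>(x, y)\<close>-plane. The divergence satisfies \<open>div [v, w] = v (div w) - w (div v)\<close>, and fields in \<open>\<hh>\<close> do not
  differentiate in \<open>z\<close>, so \<open>F_K\<close> is a cocycle without any case distinction over pairs of generators
  (\<open>divergence_bracket\<close>, \<open>div_cochain_cocycle\<close>). The only computation is that \<open>\<hh>\<close> is closed under
  brackets (\<open>bracket_in_\<hh>\<close>).

  Conversely, a cocycle is brought to the form \<open>F_K\<close> degree by degree. On the translations \<open>p\<close>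
  and \<open>q\<close> it is a closed one-form in \<open>(x, y)\<close> depending smoothly on \<open>z\<close>, and the Poincare lemma with
  parameter provides a coboundary that removes it (\<open>translations_exact\<close>). The obstruction that the form is
  closed only up to a constant disappears thanks to the dilations in \<open>\<hh>\<close>. After that, brackets with \<open>p\<close> and \<open>q\<close>
  bound the degree in \<open>(x, y)\<close> of all the other values; the remaining brackets fix their coefficients up to a
  function of \<open>z\<close> and the coboundary of a linear form (\<open>linear_part_normal_form\<close>,
  \<open>quadratic_part_normal_form\<close>).

  The analytic input is the commutation of \<open>p\<close> and \<open>q\<close> on smooth functions (\<open>dir_deriv_commute\<close>) and the
  Poincare homotopy in the planes of constant \<open>z\<close> (\<open>plane_integral_homotopy\<close>). Both rest on
  differentiation under the integral sign.

  Finally, the gauge transformation by \<open>\<mu>\<close> changes the cocycle of a Lie algebra of operators by the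
  coboundary of \<open>\<mu>\<close> (\<open>gauge_image_assoc_algebra\<close>), so the normal form of cocycles is a normal form of
  these Lie algebras.\<close>

section \<open>Smooth functions\<close>

lemma smooth_fun_eqI: "(\<And>u. Rep_smooth_fun f u = Rep_smooth_fun g u) \<Longrightarrow> f = g"
  by (simp add: Rep_smooth_fun_inject[symmetric] fun_eq_iff)

lemmas smooth_fun_rep_eq = zero_smooth_fun.rep_eq one_smooth_fun.rep_eq plus_smooth_fun.rep_eq
  times_smooth_fun.rep_eq scaleR_smooth_fun.rep_eq uminus_smooth_fun.rep_eq
  minus_smooth_fun.rep_eq exp_smooth.rep_eq coord.rep_eq of_z.rep_eq

lemma smooth_fun_has_derivative:
  "(Rep_smooth_fun f has_derivative (\<lambda>v. Rep_smooth_fun (dir_deriv v f) x)) (at x)"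
proof -
  have "Ck 1 (Rep_smooth_fun f)"
    using Rep_smooth_fun[of f] unfolding smooth_def by blast
  then show ?thesis
    by (simp add: dir_deriv.rep_eq frechet_derivative_works[symmetric])
qed

lemma dir_deriv_eqI:
  assumes "\<And>x. (Rep_smooth_fun f has_derivative f' x) (at x)"
    and "\<And>x. f' x v = Rep_smooth_fun g x"
  shows "dir_deriv v f = g"
proof (rule smooth_fun_eqI)
  fix x
  from has_derivative_unique[OF smooth_fun_has_derivative assms(1)]
  have "(\<lambda>v. Rep_smooth_fun (dir_deriv v f) x) = f' x" .
  then show "Rep_smooth_fun (dir_deriv v f) x = Rep_smooth_fun g x"
    by (simp add: fun_eq_iff assms(2))
qed

lemma smooth_fun_continuous_on:
  fixes f :: "'a::euclidean_space smooth_fun" and g :: "'b::topological_space \<Rightarrow> 'a"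
  assumes "continuous_on S g"
  shows "continuous_on S (\<lambda>x. Rep_smooth_fun f (g x))"
proof -
  have "continuous_on UNIV (Rep_smooth_fun f)"
    using Rep_smooth_fun[of f] Ck.simps(1) unfolding smooth_def by blast
  from continuous_on_compose2[OF this assms] show ?thesis by simp
qed

lemma dir_deriv_compose:
  assumes "(g has_derivative g') (at x within S)"
  shows "((\<lambda>x. Rep_smooth_fun f (g x)) has_derivative
    (\<lambda>v. Rep_smooth_fun (dir_deriv (g' v) f) (g x))) (at x within S)"
  using has_derivative_compose[OF assms smooth_fun_has_derivative] .

lemma dir_deriv_direction:
  "dir_deriv (v + w) f = dir_deriv v f + dir_deriv w f"
  "dir_deriv (c *\<^sub>R v) f = c *\<^sub>R dir_deriv v f"
proof -
  have lin: "linear (\<lambda>v. Rep_smooth_fun (dir_deriv v f) x)" for x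
    using smooth_fun_has_derivative has_derivative_linear by blast
  then show "dir_deriv (v + w) f = dir_deriv v f + dir_deriv w f"
    "dir_deriv (c *\<^sub>R v) f = c *\<^sub>R dir_deriv v f"
    by (auto intro!: smooth_fun_eqI simp: smooth_fun_rep_eq linear_add[OF lin] linear_scale[OF lin])
qed

lemma dir_deriv_add: "dir_deriv v (f + g) = dir_deriv v f + dir_deriv v g"
proof (rule dir_deriv_eqI)
  fix x
  show "(Rep_smooth_fun (f + g) has_derivative
     (\<lambda>v. Rep_smooth_fun (dir_deriv v f) x + Rep_smooth_fun (dir_deriv v g) x)) (at x)"
    unfolding smooth_fun_rep_eq by (intro has_derivative_add smooth_fun_has_derivative)
qed (simp add: smooth_fun_rep_eq)

lemma dir_deriv_mult: "dir_deriv v (f * g) = dir_deriv v f * g + f * dir_deriv v g"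
proof (rule dir_deriv_eqI)
  fix x
  show "(Rep_smooth_fun (f * g) has_derivative
     (\<lambda>v. Rep_smooth_fun f x * Rep_smooth_fun (dir_deriv v g) x
        + Rep_smooth_fun (dir_deriv v f) x * Rep_smooth_fun g x)) (at x)"
    unfolding smooth_fun_rep_eq by (intro has_derivative_mult smooth_fun_has_derivative)
qed (simp add: smooth_fun_rep_eq)

lemma dir_deriv_scaleR: "dir_deriv v (c *\<^sub>R f) = c *\<^sub>R dir_deriv v f"
proof (rule dir_deriv_eqI)
  fix x
  show "(Rep_smooth_fun (c *\<^sub>R f) has_derivative
     (\<lambda>v. c * Rep_smooth_fun (dir_deriv v f) x)) (at x)"
    unfolding smooth_fun_rep_eq by (intro has_derivative_mult_right smooth_fun_has_derivative)
qed (simp add: smooth_fun_rep_eq)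

lemma dir_deriv_exp: "dir_deriv v (exp_smooth f) = exp_smooth f * dir_deriv v f"
proof (rule dir_deriv_eqI)
  fix x
  show "(Rep_smooth_fun (exp_smooth f) has_derivative
     (\<lambda>v. Rep_smooth_fun (dir_deriv v f) x * exp (Rep_smooth_fun f x))) (at x)"
    unfolding smooth_fun_rep_eq using has_derivative_exp[OF smooth_fun_has_derivative] by (simp add: mult.commute)
qed (simp add: smooth_fun_rep_eq)

lemma dir_deriv_coord: "dir_deriv v (coord i) = (v $ i) *\<^sub>R 1"
proof (rule dir_deriv_eqI)
  fix x
  show "(Rep_smooth_fun (coord i) has_derivative (\<lambda>v. v $ i)) (at x)"
    unfolding smooth_fun_rep_eq
    by (intro bounded_linear_imp_has_derivative bounded_linear_vec_nth)
qed (simp add: smooth_fun_rep_eq)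

lemma dir_deriv_of_z: "dir_deriv v (of_z K) = (v $ 3) *\<^sub>R of_z (dir_deriv 1 K)"
proof (rule dir_deriv_eqI)
  fix x :: "real^3"
  show "(Rep_smooth_fun (of_z K) has_derivative (\<lambda>v. Rep_smooth_fun (dir_deriv (v $ 3) K) (x $ 3))) (at x)"
    unfolding smooth_fun_rep_eq
    by (intro dir_deriv_compose bounded_linear_imp_has_derivative bounded_linear_vec_nth)
  show "Rep_smooth_fun (dir_deriv (v $ 3) K) (x $ 3)
    = Rep_smooth_fun ((v $ 3) *\<^sub>R of_z (dir_deriv 1 K)) x"
    using dir_deriv_direction(2)[of "v $ 3" 1 K] by (simp add: smooth_fun_rep_eq)
qed

lemma smooth_fun_increment:
  "Rep_smooth_fun f (x + v) - Rep_smooth_fun f x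
    = integral {0..1} (\<lambda>t. Rep_smooth_fun (dir_deriv v f) (x + t *\<^sub>R v))"
proof -
  have line: "((\<lambda>t. x + t *\<^sub>R v) has_derivative (\<lambda>s. s *\<^sub>R v)) (at t within {0..1})" for t
    by (auto intro!: derivative_eq_intros)
  have "((\<lambda>t. Rep_smooth_fun f (x + t *\<^sub>R v)) has_vector_derivative
      Rep_smooth_fun (dir_deriv v f) (x + t *\<^sub>R v)) (at t within {0..1})" for t
    using dir_deriv_compose[OF line]
    by (simp add: has_vector_derivative_def dir_deriv_direction smooth_fun_rep_eq)
  from fundamental_theorem_of_calculus[OF zero_le_one this]
  show ?thesis by (auto dest!: integral_unique)
qed

text \<open>Differentiation under the integral sign, with continuity required of each directional derivative
  only: in finite dimension this already makes the derivative continuous in operator norm.\<close>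

lemma integral_has_derivative_param:
  fixes h :: "'a::euclidean_space \<Rightarrow> real \<Rightarrow> real"
  assumes deriv: "\<And>u t. ((\<lambda>u. h u t) has_derivative h' u t) (at u)"
    and cont_h: "\<And>u. continuous_on {0..1} (h u)"
    and cont_h': "\<And>v. continuous_on (UNIV \<times> {0..1}) (\<lambda>(u, t). h' u t v)"
  shows "((\<lambda>u. integral {0..1} (h u)) has_derivative (\<lambda>v. integral {0..1} (\<lambda>t. h' u t v))) (at u)"
proof -
  define D where "D u t = Blinfun (h' u t)" for u t
  have D: "blinfun_apply (D u t) = h' u t" for u t
    using deriv unfolding D_def by (intro bounded_linear_Blinfun_apply has_derivative_bounded_linear)
  have cont_D: "continuous_on (UNIV \<times> cbox 0 1) (\<lambda>(u, t). D u t)"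
    using cont_h' by (intro continuous_on_blinfun_componentwise) (simp add: case_prod_beta D)
  have "((\<lambda>u. integral (cbox 0 1) (h u)) has_derivative integral (cbox 0 1) (D u)) (at u within UNIV)"
    using deriv cont_h cont_D
    by (intro leibniz_rule) (auto simp: D intro!: integrable_continuous_interval)
  moreover have "D u integrable_on {0..1}"
  proof (rule integrable_continuous_interval)
    show "continuous_on {0..1} (D u)"
      using continuous_on_compose2[OF cont_D, of "{0..1}" "\<lambda>t. (u, t)"]
      by (simp add: continuous_intros image_subset_iff)
  qed
  then have "blinfun_apply (integral (cbox 0 1) (D u)) v = integral {0..1} (\<lambda>t. h' u t v)" for v
    by (simp add: blinfun_apply_integral D)
  then have "blinfun_apply (integral (cbox 0 1) (D u)) = (\<lambda>v. integral {0..1} (\<lambda>t. h' u t v))" ..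
  ultimately show ?thesis by simp
qed

text \<open>Equality of mixed derivatives. The increment of \<open>f\<close> along \<open>s *\<^sub>R v\<close> is \<open>s\<close> times an integral of
  \<open>dir_deriv v f\<close>; differentiating it in direction \<open>w\<close> under the integral sign, and writing the
  increment of \<open>dir_deriv w f\<close> in the same way, gives two integrals that agree for \<open>s \<noteq> 0\<close>. By
  continuity they agree for \<open>s = 0\<close>, where each is the value at the base point of one of the mixed
  derivatives.\<close>

lemma dir_deriv_commute: "dir_deriv v (dir_deriv w f) = dir_deriv w (dir_deriv v f)"
proof (rule smooth_fun_eqI)
  fix x
  define J where "J g s = integral (cbox 0 1) (\<lambda>t. Rep_smooth_fun g (x + t *\<^sub>R s *\<^sub>R v))" for g s
  have cont_J: "continuous_on UNIV (J g)" for g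
    unfolding J_def case_prod_beta
    by (rule integral_continuous_on_param) (auto simp: case_prod_beta intro!: smooth_fun_continuous_on continuous_intros)
  have "s * J (dir_deriv v (dir_deriv w f)) s = s * J (dir_deriv w (dir_deriv v f)) s" for s
  proof -
    have increment: "Rep_smooth_fun g (y + s *\<^sub>R v) - Rep_smooth_fun g y
      = integral {0..1} (\<lambda>t. s * Rep_smooth_fun (dir_deriv v g) (y + t *\<^sub>R s *\<^sub>R v))" for g y
      using smooth_fun_increment[of g y "s *\<^sub>R v"] by (simp add: dir_deriv_direction smooth_fun_rep_eq)
    have "((\<lambda>y. integral {0..1} (\<lambda>t. s * Rep_smooth_fun (dir_deriv v f) (y + t *\<^sub>R s *\<^sub>R v))) has_derivative
      (\<lambda>w. integral {0..1} (\<lambda>t. s * Rep_smooth_fun (dir_deriv w (dir_deriv v f)) (x + t *\<^sub>R s *\<^sub>R v)))) (at x)"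
    proof (rule integral_has_derivative_param)
      fix y t
      show "((\<lambda>y. s * Rep_smooth_fun (dir_deriv v f) (y + t *\<^sub>R s *\<^sub>R v)) has_derivative
        (\<lambda>w. s * Rep_smooth_fun (dir_deriv w (dir_deriv v f)) (y + t *\<^sub>R s *\<^sub>R v))) (at y)"
        by (intro has_derivative_mult_right dir_deriv_compose[of _ "\<lambda>w. w"])
           (auto intro!: derivative_eq_intros)
    qed (auto simp: case_prod_beta intro!: continuous_intros smooth_fun_continuous_on)
    moreover have "((\<lambda>y. Rep_smooth_fun f (y + s *\<^sub>R v) - Rep_smooth_fun f y) has_derivative
      (\<lambda>w. Rep_smooth_fun (dir_deriv w f) (x + s *\<^sub>R v) - Rep_smooth_fun (dir_deriv w f) x)) (at x)"
      by (intro has_derivative_diff smooth_fun_has_derivative dir_deriv_compose[of _ "\<lambda>w. w"])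
         (auto intro!: derivative_eq_intros)
    ultimately have "(\<lambda>w. Rep_smooth_fun (dir_deriv w f) (x + s *\<^sub>R v) - Rep_smooth_fun (dir_deriv w f) x)
      = (\<lambda>w. integral {0..1} (\<lambda>t. s * Rep_smooth_fun (dir_deriv w (dir_deriv v f)) (x + t *\<^sub>R s *\<^sub>R v)))"
      unfolding increment by (rule has_derivative_unique[rotated])
    with increment[of "dir_deriv w f" x] show ?thesis
      by (auto simp: fun_eq_iff J_def)
  qed
  then have "J (dir_deriv v (dir_deriv w f)) s = J (dir_deriv w (dir_deriv v f)) s" if "s \<noteq> 0" for s
    using that mult_left_cancel by blast
  moreover have "J g \<midarrow>0\<rightarrow> J g 0" for g
    using cont_J[of g] by (simp add: continuous_on_eq_continuous_at isCont_def)
  ultimately have "J (dir_deriv v (dir_deriv w f)) 0 = J (dir_deriv w (dir_deriv v f)) 0"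
    by (metis (no_types, lifting) LIM_equal LIM_unique)
  then show "Rep_smooth_fun (dir_deriv v (dir_deriv w f)) x = Rep_smooth_fun (dir_deriv w (dir_deriv v f)) x"
    by (simp add: J_def)
qed


section \<open>The Poincare lemma along the planes of constant z\<close>

text \<open>The weight \<open>g\<close> is arbitrary because differentiation turns \<open>g t\<close> into \<open>g t * t\<close> on the moving
  end of the segment; this makes the class of such integrals closed under differentiation, which is
  what the induction for smoothness needs.\<close>

lemma segment_integral_has_derivative:
  fixes f :: "'a::euclidean_space smooth_fun" and A B :: "'b::euclidean_space \<Rightarrow> 'a"
  assumes A: "bounded_linear A" and B: "bounded_linear B" and g: "continuous_on {0..1} g"
  shows "((\<lambda>u. integral {0..1} (\<lambda>t. g t * Rep_smooth_fun f (A u + t *\<^sub>R B u))) has_derivative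
    (\<lambda>v. integral {0..1} (\<lambda>t. g t * Rep_smooth_fun (dir_deriv (A v) f) (A u + t *\<^sub>R B u))
       + integral {0..1} (\<lambda>t. g t * t * Rep_smooth_fun (dir_deriv (B v) f) (A u + t *\<^sub>R B u)))) (at u)"
proof -
  note contAB = bounded_linear.continuous_on[OF A] bounded_linear.continuous_on[OF B]
  have g_snd: "continuous_on (UNIV \<times> {0..1}) (\<lambda>x. g (snd x))"
    by (rule continuous_on_compose2[OF g]) (auto intro!: continuous_intros)
  have integrable: "(\<lambda>t. h t * Rep_smooth_fun f (A u + t *\<^sub>R B u)) integrable_on {0..1}"
    if "continuous_on {0..1} h" for h u f
    using that by (intro integrable_continuous_interval continuous_intros smooth_fun_continuous_on)
  have "((\<lambda>u. integral {0..1} (\<lambda>t. g t * Rep_smooth_fun f (A u + t *\<^sub>R B u))) has_derivative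
    (\<lambda>v. integral {0..1} (\<lambda>t. g t * Rep_smooth_fun (dir_deriv (A v + t *\<^sub>R B v) f) (A u + t *\<^sub>R B u)))) (at u)"
  proof (rule integral_has_derivative_param)
    fix u t
    show "((\<lambda>u. g t * Rep_smooth_fun f (A u + t *\<^sub>R B u)) has_derivative
      (\<lambda>v. g t * Rep_smooth_fun (dir_deriv (A v + t *\<^sub>R B v) f) (A u + t *\<^sub>R B u))) (at u)"
      by (intro has_derivative_mult_right dir_deriv_compose has_derivative_add
          has_derivative_scaleR_right bounded_linear_imp_has_derivative A B)
  next
    fix u show "continuous_on {0..1} (\<lambda>t. g t * Rep_smooth_fun f (A u + t *\<^sub>R B u))"
      by (intro continuous_intros smooth_fun_continuous_on g)
  next
    fix v
    have "continuous_on (UNIV \<times> {0..1}) (\<lambda>x. g (snd x) * (Rep_smooth_fun (dir_deriv (A v) f) (A (fst x) + snd x *\<^sub>R B (fst x))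
      + snd x * Rep_smooth_fun (dir_deriv (B v) f) (A (fst x) + snd x *\<^sub>R B (fst x))))"
      by (intro continuous_intros smooth_fun_continuous_on g_snd contAB)
    then show "continuous_on (UNIV \<times> {0..1})
      (\<lambda>(u, t). g t * Rep_smooth_fun (dir_deriv (A v + t *\<^sub>R B v) f) (A u + t *\<^sub>R B u))"
      by (simp add: case_prod_beta dir_deriv_direction smooth_fun_rep_eq)
  qed
  moreover have "integral {0..1} (\<lambda>t. g t * Rep_smooth_fun (dir_deriv (A v + t *\<^sub>R B v) f) (A u + t *\<^sub>R B u))
    = integral {0..1} (\<lambda>t. g t * Rep_smooth_fun (dir_deriv (A v) f) (A u + t *\<^sub>R B u))
       + integral {0..1} (\<lambda>t. g t * t * Rep_smooth_fun (dir_deriv (B v) f) (A u + t *\<^sub>R B u))" for v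
    by (subst integral_add[OF integrable[OF g] integrable[OF continuous_on_mult[OF g continuous_on_id]], symmetric])
       (simp add: dir_deriv_direction smooth_fun_rep_eq distrib_left mult.assoc)
  ultimately show ?thesis by simp
qed

lemma segment_integral_Ck:
  fixes f :: "'a::euclidean_space smooth_fun" and A B :: "'b::euclidean_space \<Rightarrow> 'a"
  assumes A: "bounded_linear A" and B: "bounded_linear B"
  shows "continuous_on {0..1} g \<Longrightarrow>
    Ck n (\<lambda>u. integral {0..1} (\<lambda>t. g t * Rep_smooth_fun f (A u + t *\<^sub>R B u)))"
proof (induction n arbitrary: f g)
  case 0
  then show ?case
    using segment_integral_has_derivative[OF A B 0]
    by (auto intro!: has_derivative_continuous_on)
next
  case (Suc n)
  note deriv = segment_integral_has_derivative[OF A B Suc.prems, of f]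
  have "continuous_on {0..1} (\<lambda>t. g t * t)" using Suc.prems by (intro continuous_intros)
  have "Ck n (\<lambda>u. integral {0..1} (\<lambda>t. g t * Rep_smooth_fun (dir_deriv (A v) f) (A u + t *\<^sub>R B u))
       + integral {0..1} (\<lambda>t. g t * t * Rep_smooth_fun (dir_deriv (B v) f) (A u + t *\<^sub>R B u)))" for v
    by (intro Ck_add Suc.IH Suc.prems) (intro continuous_intros Suc.prems)
  then show ?case
    unfolding Ck.simps frechet_derivative_at[OF deriv, symmetric] using deriv differentiable_def by blast
qed

definition z_axis_proj :: "real^3 \<Rightarrow> real^3" where
  "z_axis_proj u = axis 3 (u $ 3)"

lemma bounded_linear_z_axis_proj: "bounded_linear z_axis_proj"
  unfolding z_axis_proj_def
  by (intro linear_conv_bounded_linear[THEN iffD1] linearI) (simp_all add: axis_def vec_eq_iff)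

text \<open>The average of \<open>f\<close>, with weight \<open>g\<close>, over the horizontal segment from the point of the z-axis at
  the height of \<open>u\<close> to \<open>u\<close>. It carries the homotopy operator of the Poincare lemma in the planes of
  constant \<open>z\<close>. The weight has to be continuous for the result to be smooth.\<close>

definition plane_integral :: "(real \<Rightarrow> real) \<Rightarrow> F3 \<Rightarrow> F3" where
  "plane_integral g f = Abs_smooth_fun (\<lambda>u. integral {0..1}
    (\<lambda>t. g t * Rep_smooth_fun f (z_axis_proj u + t *\<^sub>R (u - z_axis_proj u))))"

lemma Rep_plane_integral:
  assumes "continuous_on {0..1} g"
  shows "Rep_smooth_fun (plane_integral g f) = (\<lambda>u. integral {0..1}
    (\<lambda>t. g t * Rep_smooth_fun f (z_axis_proj u + t *\<^sub>R (u - z_axis_proj u))))"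
  unfolding plane_integral_def
  by (intro Abs_smooth_fun_inverse CollectI)
     (auto simp: smooth_def intro!: segment_integral_Ck[OF _ _ assms] bounded_linear_z_axis_proj
       bounded_linear_sub bounded_linear_ident)

lemma plane_derivations_rep:
  "Rep_smooth_fun (dir_deriv (u - z_axis_proj u) f) w
    = u $ 1 * Rep_smooth_fun (p f) w + u $ 2 * Rep_smooth_fun (q f) w"
proof -
  have "u - z_axis_proj u = (u $ 1) *\<^sub>R axis 1 1 + (u $ 2) *\<^sub>R axis 2 1"
    by (simp add: vec_eq_iff forall_3 z_axis_proj_def axis_def)
  then show ?thesis
    by (simp add: dir_deriv_direction p_def q_def smooth_fun_rep_eq)
qed

lemma pq_plane_integral:
  assumes g: "continuous_on {0..1} g"
  shows "p (plane_integral g f) = plane_integral (\<lambda>t. g t * t) (p f)"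
    and "q (plane_integral g f) = plane_integral (\<lambda>t. g t * t) (q f)"
proof -
  have gt: "continuous_on {0..1} (\<lambda>t. g t * t)" using g by (intro continuous_intros)
  have "dir_deriv v (plane_integral g f) = plane_integral (\<lambda>t. g t * t) (dir_deriv v f)"
    if "v $ 3 = 0" for v
  proof (rule dir_deriv_eqI, unfold Rep_plane_integral[OF g])
    show "((\<lambda>u. integral {0..1} (\<lambda>t. g t * Rep_smooth_fun f (z_axis_proj u + t *\<^sub>R (u - z_axis_proj u))))
      has_derivative
    (\<lambda>v. integral {0..1} (\<lambda>t. g t * Rep_smooth_fun (dir_deriv (z_axis_proj v) f) (z_axis_proj u + t *\<^sub>R (u - z_axis_proj u)))
       + integral {0..1} (\<lambda>t. g t * t * Rep_smooth_fun (dir_deriv (v - z_axis_proj v) f) (z_axis_proj u + t *\<^sub>R (u - z_axis_proj u))))) (at u)" for u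
      by (intro segment_integral_has_derivative g bounded_linear_z_axis_proj
       bounded_linear_sub bounded_linear_ident)
    have "z_axis_proj v = 0" using that by (simp add: z_axis_proj_def axis_def vec_eq_iff)
    moreover have "dir_deriv 0 f = 0"
      using dir_deriv_direction(2)[of 0 0 f] by simp
    ultimately show "integral {0..1} (\<lambda>t. g t * Rep_smooth_fun (dir_deriv (z_axis_proj v) f) (z_axis_proj u + t *\<^sub>R (u - z_axis_proj u)))
       + integral {0..1} (\<lambda>t. g t * t * Rep_smooth_fun (dir_deriv (v - z_axis_proj v) f) (z_axis_proj u + t *\<^sub>R (u - z_axis_proj u)))
       = Rep_smooth_fun (plane_integral (\<lambda>t. g t * t) (dir_deriv v f)) u" for u
      by (simp add: Rep_plane_integral[OF gt] smooth_fun_rep_eq)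
  qed
  from this[of "axis 1 1"] this[of "axis 2 1"]
  show "p (plane_integral g f) = plane_integral (\<lambda>t. g t * t) (p f)"
    "q (plane_integral g f) = plane_integral (\<lambda>t. g t * t) (q f)"
    by (simp_all add: p_def q_def axis_def)
qed

text \<open>The integrand on the left is the \<open>t\<close>-derivative of \<open>t * f\<close> along the segment. For a closed pair
  \<open>p b = q a\<close> it is exactly the statement that \<open>cx * plane_integral (\<lambda>_. 1) a + cy * plane_integral (\<lambda>_. 1) b\<close>
  is a potential, smooth also in \<open>z\<close>.\<close>

lemma plane_integral_homotopy:
  "plane_integral (\<lambda>_. 1) f + cx * plane_integral (\<lambda>t. t) (p f) + cy * plane_integral (\<lambda>t. t) (q f) = f"
proof (rule smooth_fun_eqI)
  fix u
  define \<gamma> where "\<gamma> t = z_axis_proj u + t *\<^sub>R (u - z_axis_proj u)" for t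
  have cont_\<gamma>: "continuous_on {0..1} \<gamma>"
    unfolding \<gamma>_def by (intro continuous_intros)
  have \<gamma>': "(\<gamma> has_derivative (\<lambda>s. s *\<^sub>R (u - z_axis_proj u))) (at t within {0..1})" for t
    unfolding \<gamma>_def by (auto intro!: derivative_eq_intros)
  have integrable: "(\<lambda>t. Rep_smooth_fun g (\<gamma> t)) integrable_on {0..1}"
    "(\<lambda>t. c * (t * Rep_smooth_fun g (\<gamma> t))) integrable_on {0..1}" for g c
    by (intro integrable_continuous_interval continuous_intros smooth_fun_continuous_on cont_\<gamma>)+
  have "((\<lambda>t. Rep_smooth_fun f (\<gamma> t)) has_real_derivative
      Rep_smooth_fun (dir_deriv (u - z_axis_proj u) f) (\<gamma> t)) (at t within {0..1})" for t
    using dir_deriv_compose[OF \<gamma>'[of t], of f]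
    by (simp add: has_field_derivative_def dir_deriv_direction smooth_fun_rep_eq mult_commute_abs)
  from DERIV_mult[OF DERIV_ident this]
  have "((\<lambda>t. t * Rep_smooth_fun f (\<gamma> t)) has_vector_derivative
    (Rep_smooth_fun f (\<gamma> t) + (u $ 1 * (t * Rep_smooth_fun (p f) (\<gamma> t)) + u $ 2 * (t * Rep_smooth_fun (q f) (\<gamma> t)))))
      (at t within {0..1})" for t
    unfolding has_real_derivative_iff_has_vector_derivative[symmetric]
    by (rule DERIV_cong) (simp add: plane_derivations_rep algebra_simps)
  from integral_unique[OF fundamental_theorem_of_calculus[OF zero_le_one this]]
  have "Rep_smooth_fun f u = integral {0..1} (\<lambda>t. Rep_smooth_fun f (\<gamma> t) + (u $ 1 * (t * Rep_smooth_fun (p f) (\<gamma> t))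
      + u $ 2 * (t * Rep_smooth_fun (q f) (\<gamma> t))))"
    by (simp add: \<gamma>_def)
  also have "\<dots> = integral {0..1} (\<lambda>t. Rep_smooth_fun f (\<gamma> t))
      + (u $ 1 * integral {0..1} (\<lambda>t. t * Rep_smooth_fun (p f) (\<gamma> t))
      + u $ 2 * integral {0..1} (\<lambda>t. t * Rep_smooth_fun (q f) (\<gamma> t)))"
    by (simp only: integral_add integrable integrable_add integral_mult_right)
  finally show "Rep_smooth_fun (plane_integral (\<lambda>_. 1) f + cx * plane_integral (\<lambda>t. t) (p f)
      + cy * plane_integral (\<lambda>t. t) (q f)) u = Rep_smooth_fun f u"
    by (simp only: smooth_fun_rep_eq Rep_plane_integral[OF continuous_on_const]
        Rep_plane_integral[OF continuous_on_id] \<gamma>_def mult_1_left add.assoc)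
qed

lemma of_z_if_pq_zero:
  assumes "p f = 0" "q f = 0"
  obtains K where "f = of_z K"
proof
  define K where "K = Abs_smooth_fun (\<lambda>z. Rep_smooth_fun f (axis 3 z))"
  have "bounded_linear (axis 3 :: real \<Rightarrow> real^3)"
    by (intro linear_conv_bounded_linear[THEN iffD1] linearI) (simp_all add: axis_def vec_eq_iff)
  then have "smooth (\<lambda>z. Rep_smooth_fun f (axis 3 z))"
    using Rep_smooth_fun[of f] Ck_compose_linear unfolding smooth_def by blast
  then have K: "Rep_smooth_fun K z = Rep_smooth_fun f (axis 3 z)" for z
    by (simp add: K_def Abs_smooth_fun_inverse)
  show "f = of_z K"
  proof (rule smooth_fun_eqI)
    fix u
    have "Rep_smooth_fun (dir_deriv (u - z_axis_proj u) f) w = 0" for w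
      using assms by (simp add: plane_derivations_rep smooth_fun_rep_eq)
    with smooth_fun_increment[of f "z_axis_proj u" "u - z_axis_proj u"]
    show "Rep_smooth_fun f u = Rep_smooth_fun (of_z K) u"
      by (simp add: smooth_fun_rep_eq K z_axis_proj_def)
  qed
qed

section \<open>Vector fields tangent to the planes\<close>

lemma pq_const [simp]: "p 0 = 0" "q 0 = 0" "p 1 = 0" "q 1 = 0"
  "p (of_real c) = 0" "q (of_real c) = 0" "p (numeral n) = 0" "q (numeral n) = 0"
proof -
  have "dir_deriv v 1 = 0" for v :: "real^3"
    using dir_deriv_mult[of v 1 1] by simp
  then have "dir_deriv v (of_real c) = 0" for v :: "real^3" and c
    by (simp add: of_real_def dir_deriv_scaleR)
  from this[of _ c] this[of _ 0] this[of _ 1] this[of _ "numeral n"]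
  show "p 0 = 0" "q 0 = 0" "p 1 = 0" "q 1 = 0"
    "p (of_real c) = 0" "q (of_real c) = 0" "p (numeral n) = 0" "q (numeral n) = 0"
    by (simp_all add: p_def q_def)
qed

lemma pq_add [simp]: "p (f + g) = p f + p g" "q (f + g) = q f + q g"
  by (simp_all add: p_def q_def dir_deriv_add)

lemma pq_minus [simp]: "p (- f) = - p f" "q (- f) = - q f"
  using dir_deriv_scaleR[of _ "-1" f] by (simp_all add: p_def q_def)

lemma pq_diff [simp]: "p (f - g) = p f - p g" "q (f - g) = q f - q g"
  using pq_add[of f "- g"] by simp_all

lemma pq_scaleR [simp]: "p (c *\<^sub>R f) = c *\<^sub>R p f" "q (c *\<^sub>R f) = c *\<^sub>R q f"
  by (simp_all add: p_def q_def dir_deriv_scaleR)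

lemma pq_mult [simp]: "p (f * g) = p f * g + f * p g" "q (f * g) = q f * g + f * q g"
  by (simp_all add: p_def q_def dir_deriv_mult)

lemma pq_coord [simp]: "p cx = 1" "q cx = 0" "p cy = 0" "q cy = 1"
  by (simp_all add: p_def q_def dir_deriv_coord axis_def)

lemma pq_of_z [simp]: "p (of_z K) = 0" "q (of_z K) = 0"
  by (simp_all add: p_def q_def dir_deriv_of_z axis_def)

lemma pq_exp [simp]: "p (exp_smooth f) = exp_smooth f * p f" "q (exp_smooth f) = exp_smooth f * q f"
  by (simp_all add: p_def q_def dir_deriv_exp)

lemma q_p_commute [simp]: "q (p f) = p (q f)"
  by (simp add: p_def q_def dir_deriv_commute)

lemma oper_apply [simp]: "(S + T) f = S f + T f" "(S - T) f = S f - T f" "(0 :: oper) f = 0"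
  "(c *\<^sub>R S) f = c *\<^sub>R S f" "(g \<odot> S) f = g * S f" "mult_op g f = g * f" for S T :: oper
  by (simp_all add: scaleR_fun_def fmul_def mult_op_def)

lemma mult_op_linear: "mult_op (f + g) = mult_op f + mult_op g" "mult_op (c *\<^sub>R f) = c *\<^sub>R mult_op f"
  by (simp_all add: fun_eq_iff algebra_simps)

lemma \<hh>_generators:
  "p \<in> \<hh>" "q \<in> \<hh>" "cx \<odot> p \<in> \<hh>" "cy \<odot> q \<in> \<hh>" "cx \<odot> q \<in> \<hh>" "cy \<odot> p \<in> \<hh>"
  "cx\<^sup>2 \<odot> p + cx * cy \<odot> q \<in> \<hh>" "cx * cy \<odot> p + cy\<^sup>2 \<odot> q \<in> \<hh>"
  unfolding \<hh>_def by (auto intro: span_base)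

lemma subspace_\<hh>: "subspace \<hh>"
  unfolding \<hh>_def by (rule subspace_span)

lemmas \<hh>_closed = subspace_0[OF subspace_\<hh>] subspace_add[OF subspace_\<hh>]
  subspace_diff[OF subspace_\<hh>] subspace_scale[OF subspace_\<hh>]

lemma \<hh>_induct [consumes 1, case_names subspace p q xp yq xq yp xE yE]:
  assumes "v \<in> \<hh>" and "subspace {v. P v}" and "P p" "P q" "P (cx \<odot> p)" "P (cy \<odot> q)" "P (cx \<odot> q)" "P (cy \<odot> p)"
    "P (cx\<^sup>2 \<odot> p + cx * cy \<odot> q)" "P (cx * cy \<odot> p + cy\<^sup>2 \<odot> q)"
  shows "P v"
  using assms(1) unfolding \<hh>_def by (induction rule: span_induct) (use assms in auto)

text \<open>An element of \<open>\<hh>\<close> is only known as a map on functions; its components as a vector field are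
  recovered as its values on the coordinates. All computations with fields reduce to \<open>p\<close> and \<open>q\<close> this way.\<close>

lemma \<hh>_apply: "v \<in> \<hh> \<Longrightarrow> v f = v cx * p f + v cy * q f"
proof (induction rule: \<hh>_induct)
  case subspace
  show ?case by (rule subspaceI) (simp_all add: algebra_simps)
qed simp_all

lemma \<hh>_eq_field: "v \<in> \<hh> \<Longrightarrow> v = v cx \<odot> p + v cy \<odot> q"
  by (rule ext) (simp, rule \<hh>_apply)

lemma \<hh>_derivation:
  assumes "v \<in> \<hh>"
  shows "v (f + g) = v f + v g" "v (f - g) = v f - v g" "v (c *\<^sub>R f) = c *\<^sub>R v f"
    "v (f * g) = v f * g + f * v g" "v (of_real c) = 0" "v (of_z K) = 0"
  unfolding \<hh>_apply[OF assms, of "_ + _"] \<hh>_apply[OF assms, of "_ - _"] \<hh>_apply[OF assms, of "_ *\<^sub>R _"]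
    \<hh>_apply[OF assms, of "_ * _"] \<hh>_apply[OF assms, of "of_real c"] \<hh>_apply[OF assms, of "of_z K"]
    \<hh>_apply[OF assms, of f] \<hh>_apply[OF assms, of g]
  by (simp_all add: algebra_simps)

lemma bracket_fields:
  "bracket (a \<odot> p + b \<odot> q) (a' \<odot> p + b' \<odot> q) =
    (a * p a' + b * q a' - a' * p a - b' * q a) \<odot> p + (a * p b' + b * q b' - a' * p b - b' * q b) \<odot> q"
  by (simp add: fun_eq_iff bracket_def algebra_simps)

text \<open>The general element of \<open>\<hh>\<close>: an affine field plus a linear form times the Euler field. These are the
  infinitesimal projective transformations of the plane, so \<open>\<hh>\<close> is a copy of \<open>sl(3)\<close>.\<close>

definition projective_field :: "real \<Rightarrow> real \<Rightarrow> real \<Rightarrow> real \<Rightarrow> real \<Rightarrow> real \<Rightarrow> real \<Rightarrow> real \<Rightarrow> oper" where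
  "projective_field a0 a1 a2 b0 b1 b2 c d =
     (of_real a0 + of_real a1 * cx + of_real a2 * cy + (of_real c * cx + of_real d * cy) * cx) \<odot> p
   + (of_real b0 + of_real b1 * cx + of_real b2 * cy + (of_real c * cx + of_real d * cy) * cy) \<odot> q"

lemma projective_field_in_\<hh>: "projective_field a0 a1 a2 b0 b1 b2 c d \<in> \<hh>"
proof -
  have "projective_field a0 a1 a2 b0 b1 b2 c d = a0 *\<^sub>R p + a1 *\<^sub>R (cx \<odot> p) + a2 *\<^sub>R (cy \<odot> p)
    + b0 *\<^sub>R q + b1 *\<^sub>R (cx \<odot> q) + b2 *\<^sub>R (cy \<odot> q)
    + c *\<^sub>R (cx\<^sup>2 \<odot> p + cx * cy \<odot> q) + d *\<^sub>R (cx * cy \<odot> p + cy\<^sup>2 \<odot> q)"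
    by (simp add: projective_field_def fun_eq_iff of_real_def algebra_simps power2_eq_square)
  then show ?thesis
    by (simp add: \<hh>_closed \<hh>_generators)
qed

lemma \<hh>_projective_field:
  assumes "v \<in> \<hh>"
  obtains a0 a1 a2 b0 b1 b2 c d where "v = projective_field a0 a1 a2 b0 b1 b2 c d"
proof -
  obtain k1 k2 k3 k4 k5 k6 k7 k8 where "v = k1 *\<^sub>R p + k2 *\<^sub>R q + k3 *\<^sub>R (cx \<odot> p) + k4 *\<^sub>R (cy \<odot> q)
    + k5 *\<^sub>R (cx \<odot> q) + k6 *\<^sub>R (cy \<odot> p)
    + k7 *\<^sub>R (cx\<^sup>2 \<odot> p + cx * cy \<odot> q) + k8 *\<^sub>R (cx * cy \<odot> p + cy\<^sup>2 \<odot> q)"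
    using assms unfolding \<hh>_def span_breakdown_eq span_empty
    by (auto simp: algebra_simps)
  then have "v = projective_field k1 k3 k6 k2 k5 k4 k7 k8"
    by (simp add: projective_field_def fun_eq_iff of_real_def algebra_simps power2_eq_square)
  then show ?thesis by (rule that)
qed

text \<open>The commutator of two fields is affine plus a linear form times the Euler field again: the cubic
  terms cancel since both quadratic parts are multiples of the Euler field, and what remains of degree
  two comes from the linear part of each field acting on the linear form of the other.\<close>

lemma bracket_in_\<hh>:
  assumes "v \<in> \<hh>" "w \<in> \<hh>"
  shows "bracket v w \<in> \<hh>"
proof -
  obtain a0 a1 a2 b0 b1 b2 c d where v: "v = projective_field a0 a1 a2 b0 b1 b2 c d"
    using assms by (elim \<hh>_projective_field)
  obtain a0' a1' a2' b0' b1' b2' c' d' where w: "w = projective_field a0' a1' a2' b0' b1' b2' c' d'"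
    using assms by (elim \<hh>_projective_field)
  have "bracket v w = projective_field
    (a0 * a1' + b0 * a2' - (a0' * a1 + b0' * a2))
    (a1 * a1' + 2 * a0 * c' + b1 * a2' + b0 * d' - (a1' * a1 + 2 * a0' * c + b1' * a2 + b0' * d))
    (a2 * a1' + a0 * d' + b2 * a2' - (a2' * a1 + a0' * d + b2' * a2))
    (a0 * b1' + b0 * b2' - (a0' * b1 + b0' * b2))
    (a1 * b1' + b1 * b2' + b0 * c' - (a1' * b1 + b1' * b2 + b0' * c))
    (a2 * b1' + a0 * c' + b2 * b2' + 2 * b0 * d' - (a2' * b1 + a0' * c + b2' * b2 + 2 * b0' * d))
    (a1 * c' + b1 * d' - (a1' * c + b1' * d))
    (a2 * c' + b2 * d' - (a2' * c + b2' * d))"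
    unfolding v w projective_field_def bracket_fields
    by (intro arg_cong2[of _ _ _ _ "(+)"] arg_cong[of _ _ "\<lambda>g. g \<odot> _"]) (simp_all add: algebra_simps)
  then show ?thesis by (simp add: projective_field_in_\<hh>)
qed

section \<open>Functions modulo constants\<close>

lemma span_1_iff: "f \<in> span {1} \<longleftrightarrow> (\<exists>k. f = of_real k)" for f :: F3
  by (auto simp: span_singleton of_real_def)

lemma mod_const_linear [simp]:
  "mod_const 0 = 0" "mod_const (f + g) = mod_const f + mod_const g"
  "mod_const (f - g) = mod_const f - mod_const g" "mod_const (c *\<^sub>R f) = c *\<^sub>R mod_const f"
  by (transfer; simp add: span_zero)+

lemma mod_const_eq_iff: "mod_const f = mod_const g \<longleftrightarrow> (\<exists>k. f = g + of_real k)"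
proof -
  have "mod_const f = mod_const g \<longleftrightarrow> f - g \<in> span {1}"
    by transfer simp
  then show ?thesis by (auto simp: span_1_iff algebra_simps)
qed

lemma mod_const_of_real [simp]: "mod_const (of_real k) = 0"
  using mod_const_eq_iff[of "of_real k" 0] by simp

lemma mod_const_representative:
  obtains f where "x = mod_const f"
proof -
  have "\<exists>f. x = mod_const f"
    by transfer (metis diff_self span_zero)
  then show ?thesis using that by blast
qed

section \<open>The divergence cocycle\<close>

text \<open>The divergence in the \<open>(x, y)\<close>-plane. It explains the numbers in \<open>F_K\<close>: on the eight generators it takes the
  values \<open>0, 0, 1, 1, 0, 0, 3x, 3y\<close>, so \<open>F_K\<close> is \<open>K\<close> times the divergence.\<close>

definition divergence :: "oper \<Rightarrow> F3" where
  "divergence v = p (v cx) + q (v cy)"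

lemma divergence_linear [simp]:
  "divergence 0 = 0" "divergence (v + w) = divergence v + divergence w" "divergence (c *\<^sub>R v) = c *\<^sub>R divergence v"
  by (simp_all add: divergence_def algebra_simps)

text \<open>The divergence is a cocycle with values in functions. Multiplication by \<open>of_z K\<close> preserves this
  because the fields in \<open>\<hh>\<close> annihilate functions of \<open>z\<close>.\<close>

lemma divergence_bracket:
  assumes "v \<in> \<hh>" "w \<in> \<hh>"
  shows "divergence (bracket v w) = v (divergence w) - w (divergence v)"
proof -
  have "v = v cx \<odot> p + v cy \<odot> q" "w = w cx \<odot> p + w cy \<odot> q"
    using assms \<hh>_eq_field by blast+
  then obtain a b a' b' where v: "v = a \<odot> p + b \<odot> q" and w: "w = a' \<odot> p + b' \<odot> q"
    by blast
  show ?thesis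
    unfolding v w bracket_fields by (simp add: divergence_def algebra_simps)
qed

definition div_cochain :: "real smooth_fun \<Rightarrow> oper \<Rightarrow> F3_mod_const" where
  "div_cochain K v = (if v \<in> \<hh> then mod_const (of_z K * divergence v) else 0)"

lemma is_F_K_div_cochain: "is_F_K K (div_cochain K)"
proof -
  have "div_cochain K \<in> cochains1 \<hh>"
    by (auto simp: cochains1_def div_cochain_def \<hh>_closed distrib_left mult_scaleR_right)
  then show ?thesis
    by (simp add: is_F_K_def div_cochain_def \<hh>_generators)
      (simp add: divergence_def algebra_simps power2_eq_square)
qed

lemma is_F_K_unique:
  assumes F: "is_F_K K F" and G: "is_F_K K G"
  shows "F = G"
proof
  fix v
  have FG: "F \<in> cochains1 \<hh>" "G \<in> cochains1 \<hh>"
    using F G by (simp_all add: is_F_K_def)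
  show "F v = G v"
  proof (cases "v \<in> \<hh>")
    case True
    then have "v \<in> \<hh> \<and> F v = G v"
    proof (induction rule: \<hh>_induct)
      case subspace
      have "F 0 = 0" "G 0 = 0"
        using FG subspace_0[OF subspace_\<hh>] unfolding cochains1_def
        by (metis (mono_tags, lifting) mem_Collect_eq scaleR_zero_left)+
      with FG show ?case
        by (intro subspaceI) (auto simp: cochains1_def \<hh>_closed)
    next
      case xE
      show ?case using F G \<hh>_generators(7) unfolding is_F_K_def by metis
    next
      case yE
      show ?case using F G \<hh>_generators(8) unfolding is_F_K_def by metis
    qed (use F G in \<open>simp_all add: is_F_K_def \<hh>_generators del: oper_apply\<close>)
    then show ?thesis ..
  next
    case False
    with FG show ?thesis by (simp add: cochains1_def)
  qed
qed

lemma F_K_eq_div_cochain: "F_K K = div_cochain K"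
  unfolding F_K_def
  by (rule the_equality, rule is_F_K_div_cochain, rule is_F_K_unique[OF _ is_F_K_div_cochain])

lemma div_cochain_cocycle: "div_cochain K \<in> cocycles1 \<hh>"
proof -
  have "v b - w a - c \<in> span {1}"
    if vw: "v \<in> \<hh>" "w \<in> \<hh>" and reps: "mod_const a = div_cochain K v" "mod_const b = div_cochain K w"
      "mod_const c = div_cochain K (bracket v w)" for v w a b c
  proof -
    obtain k l m where "a = of_z K * divergence v + of_real k"
      "b = of_z K * divergence w + of_real l" "c = of_z K * divergence (bracket v w) + of_real m"
      using vw reps by (auto simp: div_cochain_def bracket_in_\<hh> mod_const_eq_iff)
    then have "v b - w a - c = of_real (- m)"
      using vw by (simp add: divergence_bracket \<hh>_derivation algebra_simps)
    then show ?thesis unfolding span_1_iff by blast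
  qed
  then show ?thesis
    using is_F_K_div_cochain by (simp add: cocycles1_def is_F_K_def)
qed

section \<open>Classification of the cocycles\<close>

lemma cochain_linear:
  assumes "F \<in> cochains1 \<hh>" "v \<in> \<hh>"
  shows "w \<in> \<hh> \<Longrightarrow> F (v + w) = F v + F w"
    and "w \<in> \<hh> \<Longrightarrow> F (v - w) = F v - F w"
    and "F (c *\<^sub>R v) = c *\<^sub>R F v" "F (- v) = - F v" "F 0 = 0"
proof -
  have add: "F (v + w) = F v + F w" if "w \<in> \<hh>" for w
    using assms that by (simp add: cochains1_def)
  have scale: "F (c *\<^sub>R w) = c *\<^sub>R F w" if "w \<in> \<hh>" for c w
    using assms that by (simp add: cochains1_def)
  have neg: "F (- w) = - F w" "- w \<in> \<hh>" if "w \<in> \<hh>" for w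
    using scale[OF that, of "-1"] subspace_neg[OF subspace_\<hh> that] by simp_all
  show "F (v + w) = F v + F w" "F (v - w) = F v - F w" if "w \<in> \<hh>"
    using add[OF that] add[OF neg(2)[OF that]] neg(1)[OF that] by simp_all
  show "F (c *\<^sub>R v) = c *\<^sub>R F v" "F (- v) = - F v"
    using scale neg assms by blast+
  show "F 0 = 0" using scale[OF assms(2), of 0] by simp
qed

lemma cocycle_relation:
  assumes "F \<in> cocycles1 \<hh>" "v \<in> \<hh>" "w \<in> \<hh>" "bracket v w = u"
    and "F v = mod_const a" "F w = mod_const b" "F u = mod_const c"
  shows "\<exists>k. v b - w a = c + of_real k"
proof -
  have "v b - w a - c \<in> span {1}"
    using assms unfolding cocycles1_def by (simp add: eq_commute)
  then obtain k where "v b - w a - c = of_real k"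
    unfolding span_1_iff by blast
  then have "v b - w a = c + of_real k"
    by (simp add: diff_eq_eq add.commute)
  then show ?thesis ..
qed

lemma cocycle_minus_coboundary:
  assumes F: "F \<in> cocycles1 \<hh>"
  shows "F - coboundary0 \<hh> \<mu> \<in> cocycles1 \<hh>"
proof -
  let ?G = "F - coboundary0 \<hh> \<mu>"
  have C: "F \<in> cochains1 \<hh>" using F by (simp add: cocycles1_def)
  then have "?G \<in> cochains1 \<hh>"
    by (auto simp: cochains1_def coboundary0_def \<hh>_closed scaleR_diff_right)
  moreover have "v b - w a - c \<in> span {1}"
    if vw: "v \<in> \<hh>" "w \<in> \<hh>" and "mod_const a = ?G v" "mod_const b = ?G w"
      "mod_const c = ?G (bracket v w)" for v w a b c
  proof -
    have "F v = mod_const (a + v \<mu>)" "F w = mod_const (b + w \<mu>)"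
      "F (bracket v w) = mod_const (c + bracket v w \<mu>)"
      using that by (simp_all add: coboundary0_def bracket_in_\<hh>)
    from cocycle_relation[OF F, OF vw refl this] obtain k
      where "v (b + w \<mu>) - w (a + v \<mu>) = c + bracket v w \<mu> + of_real k" ..
    then have "v b - w a - c = of_real k"
      using vw by (simp add: \<hh>_derivation bracket_def algebra_simps)
    then show ?thesis unfolding span_1_iff by blast
  qed
  ultimately show ?thesis by (simp add: cocycles1_def)
qed

lemma coboundary_add: "coboundary0 \<hh> (\<mu> + \<nu>) = coboundary0 \<hh> \<mu> + coboundary0 \<hh> \<nu>"
  by (auto simp: coboundary0_def fun_eq_iff \<hh>_derivation)

lemma brackets:
  "bracket p q = 0"
  "bracket p (cx \<odot> p) = p" "bracket q (cx \<odot> p) = 0"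
  "bracket p (cy \<odot> q) = 0" "bracket q (cy \<odot> q) = q"
  "bracket p (cx \<odot> q) = q" "bracket q (cx \<odot> q) = 0"
  "bracket p (cy \<odot> p) = 0" "bracket q (cy \<odot> p) = p"
  "bracket (cx \<odot> p) (cx \<odot> q) = cx \<odot> q" "bracket (cx \<odot> p) (cy \<odot> p) = - (cy \<odot> p)"
  "bracket (cy \<odot> q) (cx \<odot> q) = - (cx \<odot> q)" "bracket (cy \<odot> q) (cy \<odot> p) = cy \<odot> p"
  "bracket (cx \<odot> q) (cy \<odot> p) = cx \<odot> p - cy \<odot> q"
  "bracket p (cx\<^sup>2 \<odot> p + cx * cy \<odot> q) = 2 *\<^sub>R (cx \<odot> p) + cy \<odot> q"
  "bracket q (cx * cy \<odot> p + cy\<^sup>2 \<odot> q) = cx \<odot> p + 2 *\<^sub>R (cy \<odot> q)"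
  "bracket (cx \<odot> p) (cx\<^sup>2 \<odot> p + cx * cy \<odot> q) = cx\<^sup>2 \<odot> p + cx * cy \<odot> q"
  "bracket (cy \<odot> q) (cx * cy \<odot> p + cy\<^sup>2 \<odot> q) = cx * cy \<odot> p + cy\<^sup>2 \<odot> q"
  "bracket (cy \<odot> p) (cx\<^sup>2 \<odot> p + cx * cy \<odot> q) = cx * cy \<odot> p + cy\<^sup>2 \<odot> q"
  by (simp_all add: fun_eq_iff bracket_def power2_eq_square algebra_simps scaleR_2)

text \<open>The cocycle condition for \<open>p, q\<close> makes the pair \<open>(a, b)\<close> of values on \<open>p\<close> and \<open>q\<close> closed only up to a constant \<open>k\<close>.
  The constant vanishes because of the dilation \<open>cx \<odot> p\<close>: differentiating its relations with \<open>p\<close> and \<open>q\<close>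
  gives two expressions for \<open>p (q c)\<close>, whose difference is \<open>k\<close>.\<close>

lemma translations_exact:
  assumes F: "F \<in> cocycles1 \<hh>"
  obtains \<mu> where "F p = mod_const (p \<mu>)" "F q = mod_const (q \<mu>)"
proof -
  have C: "F \<in> cochains1 \<hh>" using F by (simp add: cocycles1_def)
  obtain a where a: "F p = mod_const a" by (rule mod_const_representative)
  obtain b where b: "F q = mod_const b" by (rule mod_const_representative)
  obtain c where c: "F (cx \<odot> p) = mod_const c" by (rule mod_const_representative)
  have F0: "F 0 = mod_const 0"
    by (simp only: mod_const_linear cochain_linear(5)[OF C \<hh>_generators(1)])
  obtain k where k: "p b - q a = of_real k"
    using cocycle_relation[OF F, OF \<hh>_generators(1,2) brackets(1) a b F0] by auto
  obtain l where l: "p c - cx * p a = a + of_real l"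
    using cocycle_relation[OF F, OF \<hh>_generators(1,3) brackets(2) a c a] by auto
  obtain m where m: "q c - cx * p b = of_real m"
    using cocycle_relation[OF F, OF \<hh>_generators(2,3) brackets(3) b c F0] by auto
  have "p b - q a = 0"
  proof -
    have "p (q c) - cx * p (q a) = q a" using arg_cong[OF l, of q] by simp
    moreover have "p (q c) - (p b + cx * p (p b)) = 0" using arg_cong[OF m, of p] by simp
    moreover have "p (p b) = p (q a)" using arg_cong[OF k, of p] by simp
    ultimately show ?thesis by (simp add: algebra_simps)
  qed
  then have ba: "p b = q a" by simp
  define \<mu> where "\<mu> = cx * plane_integral (\<lambda>_. 1) a + cy * plane_integral (\<lambda>_. 1) b"
  have "p \<mu> = a" "q \<mu> = b"
    using plane_integral_homotopy[of a] plane_integral_homotopy[of b] ba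
    by (simp_all add: \<mu>_def pq_plane_integral[OF continuous_on_const] algebra_simps)
  with a b show ?thesis by (intro that) auto
qed

lemma affine_if_pq_const:
  assumes "p f = of_real a" "q f = of_real b"
  obtains K where "f = of_real a * cx + of_real b * cy + of_z K"
proof -
  obtain K where "f - (of_real a * cx + of_real b * cy) = of_z K"
    using assms by (elim of_z_if_pq_zero[rotated 2]) simp_all
  then have "f = of_real a * cx + of_real b * cy + of_z K"
    by (simp add: algebra_simps)
  then show ?thesis by (rule that)
qed


text \<open>Once the values on the translations vanish, brackets with \<open>p\<close> and \<open>q\<close> force the value on each linear
  field to be affine in \<open>(x, y)\<close> with a function of \<open>z\<close> as constant term. The brackets among the linear
  fields then leave only two real parameters, which are those of the coboundary of a linear form, and
  one function of \<open>z\<close>.\<close>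

lemma linear_part_normal_form:
  assumes F: "F \<in> cocycles1 \<hh>" and Fp: "F p = 0" and Fq: "F q = 0"
  obtains \<mu> K where "(F - coboundary0 \<hh> \<mu>) p = 0" "(F - coboundary0 \<hh> \<mu>) q = 0"
    "(F - coboundary0 \<hh> \<mu>) (cx \<odot> q) = 0" "(F - coboundary0 \<hh> \<mu>) (cy \<odot> p) = 0"
    "(F - coboundary0 \<hh> \<mu>) (cx \<odot> p) = mod_const (of_z K)"
    "(F - coboundary0 \<hh> \<mu>) (cy \<odot> q) = mod_const (of_z K)"
proof -
  have C: "F \<in> cochains1 \<hh>" using F by (simp add: cocycles1_def)
  have F0: "F 0 = 0" using cochain_linear(5)[OF C \<hh>_generators(1)] .
  note rep0 = Fp[folded mod_const_linear(1)] Fq[folded mod_const_linear(1)]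
  have affine: "\<exists>f a b K. F v = mod_const f \<and> f = of_real a * cx + of_real b * cy + of_z K"
    if v: "v \<in> \<hh>" and pv: "bracket p v = u" "F u = 0" and qv: "bracket q v = u'" "F u' = 0" for v u u'
  proof -
    obtain f where f: "F v = mod_const f" by (rule mod_const_representative)
    have v0: "v 0 = 0" using \<hh>_derivation(5)[OF v, of 0] by simp
    obtain a where a: "p f = of_real a"
      using cocycle_relation[OF F, OF \<hh>_generators(1) v pv(1) rep0(1) f, of 0] pv(2) v0 by auto
    obtain b where b: "q f = of_real b"
      using cocycle_relation[OF F, OF \<hh>_generators(2) v qv(1) rep0(2) f, of 0] qv(2) v0 by auto
    obtain K where "f = of_real a * cx + of_real b * cy + of_z K"
      using affine_if_pq_const[OF a b] .
    with f show ?thesis by blast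
  qed
  obtain xp a1 b1 K1 where xp: "F (cx \<odot> p) = mod_const xp" "xp = of_real a1 * cx + of_real b1 * cy + of_z K1"
    using affine[OF \<hh>_generators(3) brackets(2) Fp brackets(3) F0] by blast
  obtain yq a2 b2 K2 where yq: "F (cy \<odot> q) = mod_const yq" "yq = of_real a2 * cx + of_real b2 * cy + of_z K2"
    using affine[OF \<hh>_generators(4) brackets(4) F0 brackets(5) Fq] by blast
  obtain xq a3 b3 K3 where xq: "F (cx \<odot> q) = mod_const xq" "xq = of_real a3 * cx + of_real b3 * cy + of_z K3"
    using affine[OF \<hh>_generators(5) brackets(6) Fq brackets(7) F0] by blast
  obtain yp a4 b4 K4 where yp: "F (cy \<odot> p) = mod_const yp" "yp = of_real a4 * cx + of_real b4 * cy + of_z K4"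
    using affine[OF \<hh>_generators(6) brackets(8) F0 brackets(9) Fp] by blast
  have neg: "F (- (cy \<odot> p)) = mod_const (- yp)" "F (- (cx \<odot> q)) = mod_const (- xq)"
    using mod_const_linear(3)[of 0 yp] mod_const_linear(3)[of 0 xq]
    by (simp_all only: cochain_linear(4)[OF C] \<hh>_generators xq(1) yp(1) mod_const_linear(1) diff_0)
  have diff: "F (cx \<odot> p - cy \<odot> q) = mod_const (xp - yq)"
    by (simp only: cochain_linear(2)[OF C] \<hh>_generators xp(1) yq(1) mod_const_linear)
  obtain k1 where k1: "cx * p xq - cx * q xp = xq + of_real k1"
    using cocycle_relation[OF F, OF \<hh>_generators(3,5) brackets(10) xp(1) xq(1) xq(1)] by auto
  obtain k2 where k2: "cx * p yp - cy * p xp = - yp + of_real k2"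
    using cocycle_relation[OF F, OF \<hh>_generators(3,6) brackets(11) xp(1) yp(1) neg(1)] by auto
  obtain k3 where k3: "cy * q xq - cx * q yq = - xq + of_real k3"
    using cocycle_relation[OF F, OF \<hh>_generators(4,5) brackets(12) yq(1) xq(1) neg(2)] by auto
  obtain k4 where k4: "cy * q yp - cy * p yq = yp + of_real k4"
    using cocycle_relation[OF F, OF \<hh>_generators(4,6) brackets(13) yq(1) yp(1) yp(1)] by auto
  obtain k5 where k5: "cx * q yp - cy * p xq = xp - yq + of_real k5"
    using cocycle_relation[OF F, OF \<hh>_generators(5,6) brackets(14) xq(1) yp(1) diff] by auto
  have ab: "b1 = 0" "b3 = 0" "a4 = 0" "b4 = a1" "a3 = b2" "a2 = 0"
  proof -
    have "of_real (- b1) = (0 :: F3)" "of_real (- b3) = (0 :: F3)"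
      using arg_cong[OF k1, of p] arg_cong[OF k1, of q] by (simp_all add: xp xq algebra_simps)
    then show "b1 = 0" "b3 = 0" by simp_all
    have "of_real (2 * a4) = (0 :: F3)" "of_real (b4 - a1) = (0 :: F3)"
      using arg_cong[OF k2, of p] arg_cong[OF k2, of q] by (simp_all add: xp yp algebra_simps)
    then show "a4 = 0" "b4 = a1" unfolding of_real_eq_0_iff by simp_all
    have "of_real (a3 - b2) = (0 :: F3)"
      using arg_cong[OF k3, of p] by (simp add: yq xq algebra_simps)
    then show "a3 = b2" by simp
    have "of_real a2 = (0 :: F3)"
      using arg_cong[OF k4, of q] by (simp add: yq yp algebra_simps)
    then show "a2 = 0" by simp
  qed
  have K: "of_z K3 = of_real (- k1)" "of_z K4 = of_real k2" "of_z K2 = of_z K1 + of_real k5"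
    using k1 k2 k5 by (simp_all add: xp yq xq yp ab eq_neg_iff_add_eq_0 algebra_simps)
  define \<mu> where "\<mu> = of_real a1 * cx + of_real b2 * cy"
  show ?thesis
  proof (rule that[of \<mu> K1])
    show "(F - coboundary0 \<hh> \<mu>) p = 0" "(F - coboundary0 \<hh> \<mu>) q = 0"
      "(F - coboundary0 \<hh> \<mu>) (cx \<odot> q) = 0" "(F - coboundary0 \<hh> \<mu>) (cy \<odot> p) = 0"
      "(F - coboundary0 \<hh> \<mu>) (cx \<odot> p) = mod_const (of_z K1)"
      "(F - coboundary0 \<hh> \<mu>) (cy \<odot> q) = mod_const (of_z K1)"
      by (simp_all add: coboundary0_def \<hh>_generators \<mu>_def Fp Fq)
         (simp_all add: xp yq xq yp ab K algebra_simps)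
  qed
qed

text \<open>The value on the first quadratic field satisfies \<open>p A = 3 * of_z K + of_real a\<close>, and it has weight one
  under \<open>cx \<odot> p\<close>, which determines it. The constant \<open>a\<close> is not removed by a coboundary. It is absorbed
  into \<open>K\<close>, since the value on \<open>cx \<odot> p\<close> matters modulo constants only; the bracket with \<open>cy \<odot> p\<close> shows
  that the second quadratic field produces the same constant.\<close>

lemma quadratic_part_normal_form:
  assumes F: "F \<in> cocycles1 \<hh>" and F0: "F p = 0" "F q = 0" "F (cx \<odot> q) = 0" "F (cy \<odot> p) = 0"
    and K: "F (cx \<odot> p) = mod_const (of_z K)" "F (cy \<odot> q) = mod_const (of_z K)"
  obtains K' where "is_F_K K' F"
proof -
  let ?A = "cx\<^sup>2 \<odot> p + cx * cy \<odot> q" and ?B = "cx * cy \<odot> p + cy\<^sup>2 \<odot> q"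
  have C: "F \<in> cochains1 \<hh>" using F by (simp add: cocycles1_def)
  obtain A where A: "F ?A = mod_const A" by (rule mod_const_representative)
  obtain B where B: "F ?B = mod_const B" by (rule mod_const_representative)
  note rep0 = F0[folded mod_const_linear(1)]
  have three: "F (2 *\<^sub>R (cx \<odot> p) + cy \<odot> q) = mod_const (3 * of_z K)"
    "F (cx \<odot> p + 2 *\<^sub>R (cy \<odot> q)) = mod_const (3 * of_z K)"
  proof -
    have "3 * of_z K = of_z K + of_z K + of_z K"
      by (simp add: algebra_simps)
    then have "mod_const (3 * of_z K) = mod_const (of_z K) + mod_const (of_z K) + mod_const (of_z K)"
      by (simp only: mod_const_linear)
    then show "F (2 *\<^sub>R (cx \<odot> p) + cy \<odot> q) = mod_const (3 * of_z K)"
      "F (cx \<odot> p + 2 *\<^sub>R (cy \<odot> q)) = mod_const (3 * of_z K)"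
      by (simp_all only: cochain_linear(1,3)[OF C] \<hh>_generators \<hh>_closed K) (simp_all add: scaleR_2)
  qed
  obtain a where a: "p A = 3 * of_z K + of_real a"
    using cocycle_relation[OF F, OF \<hh>_generators(1,7) brackets(15) rep0(1) A three(1)] by auto
  obtain d where d: "q B = 3 * of_z K + of_real d"
    using cocycle_relation[OF F, OF \<hh>_generators(2,8) brackets(16) rep0(2) B three(2)] by auto
  obtain k1 where k1: "cx * p A = A + of_real k1"
    using cocycle_relation[OF F, OF \<hh>_generators(3,7) brackets(17) K(1) A A] by auto
  obtain k2 where k2: "cy * q B = B + of_real k2"
    using cocycle_relation[OF F, OF \<hh>_generators(4,8) brackets(18) K(2) B B] by auto
  obtain k3 where k3: "cy * p A = B + of_real k3"
    using cocycle_relation[OF F, OF \<hh>_generators(6,7) brackets(19) rep0(4) A B] by auto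
  have "of_real (a - d) = (0 :: F3)"
    using arg_cong[OF k3, of q] by (simp add: a d algebra_simps)
  then have ad: "d = a" by simp
  \<comment> \<open>On the quadratic fields \<open>K\<close> enters with the factor 3, the divergence of \<open>cx\<^sup>2 \<odot> p + cx * cy \<odot> q\<close> being \<open>3 * cx\<close>.\<close>
  define K' where "K' = K + of_real (a / 3)"
  have K': "of_z K' = of_z K + of_real (a / 3)"
    by (rule smooth_fun_eqI) (simp add: K'_def of_real_def smooth_fun_rep_eq)
  then have "3 * of_z K' = 3 * of_z K + of_real (3 * (a / 3))"
    by (simp only: distrib_left of_real_mult of_real_numeral)
  then have "p A = 3 * of_z K'" "q B = 3 * of_z K'"
    by (simp_all add: a d ad)
  then have "A = 3 * cx * of_z K' - of_real k1" "B = 3 * cy * of_z K' - of_real k2"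
    using k1 k2 by (simp_all add: eq_diff_eq mult.left_commute mult.assoc)
  moreover have "mod_const (of_z K) = mod_const (of_z K')"
    using K' by simp
  ultimately have "is_F_K K' F"
    using C F0 K A B by (simp add: is_F_K_def)
  then show ?thesis by (rule that)
qed

lemma cocycle_normal_form:
  assumes F: "F \<in> cocycles1 \<hh>"
  obtains K \<mu> where "F - coboundary0 \<hh> \<mu> = F_K K"
proof -
  obtain \<mu>0 where "F p = mod_const (p \<mu>0)" "F q = mod_const (q \<mu>0)"
    using translations_exact[OF F] .
  then have "(F - coboundary0 \<hh> \<mu>0) p = 0" "(F - coboundary0 \<hh> \<mu>0) q = 0"
    by (simp_all add: coboundary0_def \<hh>_generators)
  from linear_part_normal_form[OF cocycle_minus_coboundary[OF F] this]
  obtain \<mu>1 K where "(F - coboundary0 \<hh> \<mu>0 - coboundary0 \<hh> \<mu>1) p = 0"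
    "(F - coboundary0 \<hh> \<mu>0 - coboundary0 \<hh> \<mu>1) q = 0"
    "(F - coboundary0 \<hh> \<mu>0 - coboundary0 \<hh> \<mu>1) (cx \<odot> q) = 0"
    "(F - coboundary0 \<hh> \<mu>0 - coboundary0 \<hh> \<mu>1) (cy \<odot> p) = 0"
    "(F - coboundary0 \<hh> \<mu>0 - coboundary0 \<hh> \<mu>1) (cx \<odot> p) = mod_const (of_z K)"
    "(F - coboundary0 \<hh> \<mu>0 - coboundary0 \<hh> \<mu>1) (cy \<odot> q) = mod_const (of_z K)" .
  from quadratic_part_normal_form[OF cocycle_minus_coboundary[OF cocycle_minus_coboundary[OF F]] this]
  obtain K' where "is_F_K K' (F - coboundary0 \<hh> \<mu>0 - coboundary0 \<hh> \<mu>1)" .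
  then have "F - coboundary0 \<hh> (\<mu>0 + \<mu>1) = F_K K'"
    using is_F_K_unique[OF _ is_F_K_div_cochain]
    by (simp add: coboundary_add diff_diff_eq F_K_eq_div_cochain)
  then show ?thesis by (rule that)
qed

section \<open>Gauge transformations\<close>

lemma linear_gauge_transform: "linear (gauge_transform \<mu>)"
  by (rule linearI) (simp_all add: gauge_transform_def fun_eq_iff algebra_simps)

lemma exp_smooth_minus: "exp_smooth \<mu> * exp_smooth (- \<mu>) = 1"
  by (rule smooth_fun_eqI) (simp add: smooth_fun_rep_eq exp_minus)

lemma gauge_transform_mult_op: "gauge_transform \<mu> (mult_op \<eta>) = mult_op \<eta>"
proof
  fix f
  have "gauge_transform \<mu> (mult_op \<eta>) f = (exp_smooth \<mu> * exp_smooth (- \<mu>)) * (\<eta> * f)"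
    by (simp add: gauge_transform_def algebra_simps)
  then show "gauge_transform \<mu> (mult_op \<eta>) f = mult_op \<eta> f"
    by (simp add: exp_smooth_minus)
qed

lemma gauge_transform_field:
  assumes v: "v \<in> \<hh>"
  shows "gauge_transform \<mu> v = v - mult_op (v \<mu>)"
proof
  fix f
  have "v (exp_smooth (- \<mu>)) = - (exp_smooth (- \<mu>) * v \<mu>)"
    unfolding \<hh>_apply[OF v, of "exp_smooth _"] \<hh>_apply[OF v, of \<mu>] by (simp add: algebra_simps)
  then have "gauge_transform \<mu> v f = (exp_smooth \<mu> * exp_smooth (- \<mu>)) * (v f - v \<mu> * f)"
    using v by (simp add: gauge_transform_def \<hh>_derivation algebra_simps)
  then show "gauge_transform \<mu> v f = (v - mult_op (v \<mu>)) f"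
    by (simp add: exp_smooth_minus)
qed

text \<open>The generators of the normal form are the values of the linear map
  \<open>v \<mapsto> v + mult_op (of_z K * divergence v)\<close> on the generators of \<open>\<hh>\<close>.\<close>

lemma twisted_generators:
  "p + mult_op (of_z K * divergence p) = p" "q + mult_op (of_z K * divergence q) = q"
  "cx \<odot> p + mult_op (of_z K * divergence (cx \<odot> p)) = cx \<odot> p + mult_op (of_z K)"
  "cy \<odot> q + mult_op (of_z K * divergence (cy \<odot> q)) = cy \<odot> q + mult_op (of_z K)"
  "cx \<odot> q + mult_op (of_z K * divergence (cx \<odot> q)) = cx \<odot> q"
  "cy \<odot> p + mult_op (of_z K * divergence (cy \<odot> p)) = cy \<odot> p"
  "cx\<^sup>2 \<odot> p + cx * cy \<odot> q + mult_op (of_z K * divergence (cx\<^sup>2 \<odot> p + cx * cy \<odot> q))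
    = cx\<^sup>2 \<odot> p + cx * cy \<odot> q + mult_op (3 * cx * of_z K)"
  "cx * cy \<odot> p + cy\<^sup>2 \<odot> q + mult_op (of_z K * divergence (cx * cy \<odot> p + cy\<^sup>2 \<odot> q))
    = cx * cy \<odot> p + cy\<^sup>2 \<odot> q + mult_op (3 * cy * of_z K)"
  by (simp_all add: fun_eq_iff divergence_def power2_eq_square algebra_simps)

text \<open>Conjugation by \<open>exp_smooth \<mu>\<close> subtracts \<open>v \<mu>\<close> from the multiplication part over \<open>v\<close>, which is exactly the
  change of the cocycle by the coboundary of \<open>\<mu>\<close>. The freedom in the representative modulo constants is
  accounted for by \<open>mult_op 1\<close>.\<close>

lemma gauge_image_assoc_algebra:
  assumes F: "F - coboundary0 \<hh> \<mu> = F_K K"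
  shows "gauge_transform \<mu> ` assoc_algebra \<hh> F =
    span {p, q, cx \<odot> p + mult_op (of_z K), cy \<odot> p, cx \<odot> q,
      cy \<odot> q + mult_op (of_z K),
      cx\<^sup>2 \<odot> p + cx * cy \<odot> q + mult_op (3 * cx * of_z K),
      cx * cy \<odot> p + cy\<^sup>2 \<odot> q + mult_op (3 * cy * of_z K),
      mult_op 1}" (is "_ = span ?R")
proof -
  define X where "X = {v + mult_op \<eta> | v \<eta>. v \<in> \<hh> \<and> mod_const \<eta> = F v} \<union> {mult_op 1}"
  have Fv: "F v = mod_const (of_z K * divergence v + v \<mu>)" if "v \<in> \<hh>" for v
    using fun_cong[OF F, of v] that
    by (simp add: F_K_eq_div_cochain div_cochain_def coboundary0_def diff_eq_eq)
  have gauge: "gauge_transform \<mu> (v + mult_op \<eta>) = v + mult_op (\<eta> - v \<mu>)" if "v \<in> \<hh>" for v \<eta>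
    using that by (simp add: linear_add[OF linear_gauge_transform] gauge_transform_field
        gauge_transform_mult_op fun_eq_iff algebra_simps)
  have twisted: "v + mult_op (of_z K * divergence v) \<in> span ?R" if "v \<in> \<hh>" for v
    using that
  proof (induction rule: \<hh>_induct)
    case subspace
    have "linear (\<lambda>v. v + mult_op (of_z K * divergence v))"
      by (rule linearI) (simp_all add: fun_eq_iff algebra_simps)
    then have "subspace ((\<lambda>v. v + mult_op (of_z K * divergence v)) -` span ?R)"
      by (rule linear_subspace_vimage) (rule subspace_span)
    then show ?case by (simp only: vimage_def)
  qed (unfold twisted_generators, auto intro!: span_base)
  have "gauge_transform \<mu> ` X \<subseteq> span ?R"
  proof
    fix T assume "T \<in> gauge_transform \<mu> ` X"
    then consider v \<eta> where "v \<in> \<hh>" "mod_const \<eta> = F v" "T = gauge_transform \<mu> (v + mult_op \<eta>)"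
      | "T = gauge_transform \<mu> (mult_op 1)"
      by (auto simp: X_def)
    then show "T \<in> span ?R"
    proof cases
      case 1
      then obtain k where "\<eta> = of_z K * divergence v + v \<mu> + of_real k"
        using Fv mod_const_eq_iff by metis
      then have "\<eta> - v \<mu> = of_z K * divergence v + k *\<^sub>R 1"
        by (simp add: of_real_def)
      then have "T = (v + mult_op (of_z K * divergence v)) + k *\<^sub>R mult_op 1"
        using 1 by (simp only: gauge mult_op_linear add.assoc)
      moreover have "mult_op 1 \<in> span ?R" by (intro span_base) simp
      ultimately show ?thesis
        using twisted[OF 1(1)] by (simp only: span_add span_scale)
    next
      case 2
      then show ?thesis
        by (simp only: gauge_transform_mult_op) (auto intro: span_base)
    qed
  qed
  moreover have "?R \<subseteq> gauge_transform \<mu> ` X"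
  proof -
    have "v + mult_op (of_z K * divergence v) \<in> gauge_transform \<mu> ` X" if "v \<in> \<hh>" for v
    proof (rule image_eqI)
      show "v + mult_op (of_z K * divergence v)
        = gauge_transform \<mu> (v + mult_op (of_z K * divergence v + v \<mu>))"
        by (simp only: gauge[OF that] add_diff_cancel_right')
      show "v + mult_op (of_z K * divergence v + v \<mu>) \<in> X"
        unfolding X_def by (intro UnI1 CollectI exI conjI, rule refl) (simp_all only: that Fv)
    qed
    note fields = this
    have "mult_op 1 \<in> gauge_transform \<mu> ` X"
    proof (rule image_eqI)
      show "mult_op 1 = gauge_transform \<mu> (mult_op 1)" by (simp only: gauge_transform_mult_op)
      show "mult_op 1 \<in> X" by (simp add: X_def)
    qed
    with \<hh>_generators[THEN fields] show ?thesis
      unfolding twisted_generators by (intro insert_subsetI empty_subsetI)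
  qed
  ultimately have "span (gauge_transform \<mu> ` X) = span ?R"
    using span_superset unfolding span_eq by blast
  then show ?thesis
    by (simp only: assoc_algebra_def X_def[symmetric] span_linear_image[OF linear_gauge_transform])
qed

theorem mainTheorem2:
  shows "(\<forall>K. (\<exists>!F. is_F_K K F) \<and> F_K K \<in> cocycles1 \<hh>)
    \<and> (\<forall>c \<in> H1 \<hh>. \<exists>K. F_K K \<in> c)
    \<and> (\<forall>F \<in> cocycles1 \<hh>. \<exists>K \<mu>.
        gauge_transform \<mu> ` assoc_algebra \<hh> F =
        span {p, q, cx \<odot> p + mult_op (of_z K), cy \<odot> p, cx \<odot> q,
          cy \<odot> q + mult_op (of_z K),
          cx\<^sup>2 \<odot> p + cx * cy \<odot> q + mult_op (3 * cx * of_z K),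
          cx * cy \<odot> p + cy\<^sup>2 \<odot> q + mult_op (3 * cy * of_z K),
          mult_op 1})"
proof (intro conjI allI ballI)
  show "\<exists>!F. is_F_K K F" for K
    using is_F_K_div_cochain is_F_K_unique by blast
  show cocycle: "F_K K \<in> cocycles1 \<hh>" for K
    unfolding F_K_eq_div_cochain by (rule div_cochain_cocycle)
  show "\<exists>K. F_K K \<in> c" if c_H1: "c \<in> H1 \<hh>" for c
  proof -
    obtain F where F: "F \<in> cocycles1 \<hh>"
      and c: "c = {(F, G). F \<in> cocycles1 \<hh> \<and> G \<in> cocycles1 \<hh> \<and> F - G \<in> range (coboundary0 \<hh>)} `` {F}"
      using c_H1 unfolding H1_def by (rule quotientE)
    obtain K \<mu> where "F - coboundary0 \<hh> \<mu> = F_K K"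
      using cocycle_normal_form[OF F] .
    then have "F - F_K K = coboundary0 \<hh> \<mu>" by (simp add: algebra_simps)
    then have "F_K K \<in> c" using F cocycle[of K] by (auto simp: c)
    then show ?thesis ..
  qed
  show "\<exists>K \<mu>. gauge_transform \<mu> ` assoc_algebra \<hh> F =
      span {p, q, cx \<odot> p + mult_op (of_z K), cy \<odot> p, cx \<odot> q,
        cy \<odot> q + mult_op (of_z K),
        cx\<^sup>2 \<odot> p + cx * cy \<odot> q + mult_op (3 * cx * of_z K),
        cx * cy \<odot> p + cy\<^sup>2 \<odot> q + mult_op (3 * cy * of_z K),
        mult_op 1}" if "F \<in> cocycles1 \<hh>" for F
    using cocycle_normal_form[OF that] gauge_image_assoc_algebra by metis
qed

end
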